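(* Let $p:\mathbb{R}^m\to\mathbb{R}$ be a polynomial that is represented by a straight-line program whose computational graph has $N$ nodes. Then, given the straight-line program and a point $x\in\mathbb{R}^m$, the gradient $\nabla p(x)\in\mathbb{R}^m$ can be calculated in $\mathcal{O}(N)$ operations. Moreover, the Hessian $\nabla^2 p(x)\in\mathbb{R}^{m\times m}$ can be calculated in $\mathcal{O}(mN)$ operations, or equivalently in $\mathcal{O}(N)$ vector operations on $m$-dimensional vectors. The constants hidden in $\mathcal{O}(\cdot)$ are absolute: they do not depend on $m$, $N$, $p$, $x$ or the straight-line program.
   Context: Straight-line program (SLP). An SLP in $m$ variables $x=(x_1,\dots,x_m)$ is a finite sequence of nodes $f_0,f_1,\dots,f_m,f_{m+1},\dots,f_{L}$ defined as follows. The initial nodes are the constant $f_0:=1$ and the input variables $f_i:=x_i$ for $i\in\{1,\dots,m\}$. Each subsequent node $f_\ell$, $\ell>m$, is produced from earlier nodes by exactly one of the following rules, where $\alpha_\ell\in\mathbb{R}$ is a fixed coefficient and $i,j<\ell$ are indices of earlier nodes ($i=j$ is allowed): - add: $f_\ell=\alpha_\ell(f_i+f_j)$; - sub: $f_\ell=\alpha_\ell(f_i-f_j)$; - mul: $f_\ell=\alpha_\ell\, f_i f_j$; - pow: $f_\ell=\alpha_\ell\, f_i^{\,q}$, where the exponent $q$ is a fixed nonnegative integer stored with the node. The SLP represents the polynomial $p$ if its last node (the output node) equals $p(x)$ as a function of $x$. The computational graph of the SLP is the directed graph whose nodes are $f_0,\dots,f_L$, with an edge from each operand to the node computed from it; $N$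 denotes the total number of nodes of this graph (including the constant and input nodes). Cost model. An "operation" is a scalar operation on real numbers: an addition, subtraction, multiplication, or raising a real number to a fixed nonnegative integer power; each has unit cost. Storing and reading numbers by index is not a bottleneck (unit cost per number). A "vector operation on $m$-dimensional vectors" is the addition or subtraction of two vectors in $\mathbb{R}^m$, or the multiplication of a vector in $\mathbb{R}^m$ by a scalar; when counting vector operations, a scalar operation counts as at most one vector operation. Thus each vector operation costs $\mathcal{O}(m)$ scalar operations. *)

theory Defs
  imports "HOL-Analysis.Derivative" "Jordan_Normal_Form.Matrix"
begin

text \<open>A point of \<open>\<real>\<^sup>m\<close> is an element of \<^term>\<open>carrier_vec m\<close>.  The indices of vectors and
  matrices start at 0, so the input variable \<open>x\<^sub>i\<close> (\<open>1 \<le> i \<le> m\<close>) is component \<open>i - 1\<close>.\<close>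

section \<open>Polynomials, gradients, Hessians\<close>

text \<open>An exponent vector \<open>e\<close> is a function on indices, of which only the values below \<open>m\<close> matter.\<close>

definition polynomial_in :: "nat \<Rightarrow> (real vec \<Rightarrow> real) \<Rightarrow> bool" where
  "polynomial_in m p \<longleftrightarrow>
     (\<exists>(E :: (nat \<Rightarrow> nat) set) c. finite E \<and>
        (\<forall>x\<in>carrier_vec m. p x = (\<Sum>e\<in>E. c e * (\<Prod>i<m. (x $ i) ^ e i))))"

definition partial_deriv :: "nat \<Rightarrow> (real vec \<Rightarrow> real) \<Rightarrow> real vec \<Rightarrow> real" where
  "partial_deriv i f x = deriv (\<lambda>t. f (x + t \<cdot>\<^sub>v unit_vec (dim_vec x) i)) 0"

definition gradient :: "nat \<Rightarrow> (real vec \<Rightarrow> real) \<Rightarrow> real vec \<Rightarrow> real vec" where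
  "gradient m p x = vec m (\<lambda>i. partial_deriv i p x)"

definition hessian :: "nat \<Rightarrow> (real vec \<Rightarrow> real) \<Rightarrow> real vec \<Rightarrow> real mat" where
  "hessian m p x = mat m m (\<lambda>(i, j). partial_deriv i (partial_deriv j p) x)"

section \<open>Straight-line programs\<close>

datatype rule = Add nat nat | Sub nat nat | Mul nat nat | Pow nat nat

fun operands :: "rule \<Rightarrow> nat set" where
  "operands (Add i j) = {i, j}"
| "operands (Sub i j) = {i, j}"
| "operands (Mul i j) = {i, j}"
| "operands (Pow i q) = {i}"

fun rule_val :: "rule \<Rightarrow> real list \<Rightarrow> real" where
  "rule_val (Add i j) fs = fs ! i + fs ! j"
| "rule_val (Sub i j) fs = fs ! i - fs ! j"
| "rule_val (Mul i j) fs = fs ! i * fs ! j"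
| "rule_val (Pow i q) fs = (fs ! i) ^ q"

text \<open>Only the nodes after the initial ones are stored: entry \<open>k\<close> of the list is the pair of the
  coefficient \<open>\<alpha>\<^sub>l\<close> and the rule of node \<open>l = m + 1 + k\<close>.\<close>

type_synonym slp = "(real \<times> rule) list"

definition wf_slp :: "nat \<Rightarrow> slp \<Rightarrow> bool" where
  "wf_slp m P \<longleftrightarrow> (\<forall>k<length P. \<forall>i\<in>operands (snd (P ! k)). i < m + 1 + k)"

definition num_nodes :: "nat \<Rightarrow> slp \<Rightarrow> nat" where
  "num_nodes m P = m + 1 + length P"

definition node_vals :: "slp \<Rightarrow> real vec \<Rightarrow> real list" where
  "node_vals P x = foldl (\<lambda>fs (\<alpha>, r). fs @ [\<alpha> * rule_val r fs]) (1 # list_of_vec x) P"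

definition represents :: "nat \<Rightarrow> slp \<Rightarrow> (real vec \<Rightarrow> real) \<Rightarrow> bool" where
  "represents m P p \<longleftrightarrow> wf_slp m P \<and> (\<forall>x\<in>carrier_vec m. last (node_vals P x) = p x)"

section \<open>Model of computation\<close>

text \<open>Algorithms are programs for a machine with registers for natural numbers (indices and
  loop counters) and with arrays of natural numbers, of reals and of \<open>m\<close>-dimensional real vectors.
  A program is a fixed finite text; the straight-line program and the point are data in
  memory.  Reals are obtained only by scalar operations, vector operations, copying
  and conversion of natural numbers; they are neither tested nor converted to natural numbers,
  and a program contains no real constants.\<close>

record state =
  reg :: "nat \<Rightarrow> nat"
  narr :: "nat \<Rightarrow> nat \<Rightarrow> nat"
  rarr :: "nat \<Rightarrow> nat \<Rightarrow> real"
  varr :: "nat \<Rightarrow> nat \<Rightarrow> real vec"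

text \<open>The cell \<open>(a, r)\<close> is the entry of array \<open>a\<close> whose index is the content of register \<open>r\<close>.\<close>

type_synonym cell = "nat \<times> nat"

definition rd :: "(nat \<Rightarrow> nat \<Rightarrow> 'a) \<Rightarrow> state \<Rightarrow> cell \<Rightarrow> 'a" where
  "rd A s c = A (fst c) (reg s (snd c))"

definition wr :: "(nat \<Rightarrow> nat \<Rightarrow> 'a) \<Rightarrow> state \<Rightarrow> cell \<Rightarrow> 'a \<Rightarrow> nat \<Rightarrow> nat \<Rightarrow> 'a" where
  "wr A s c v = A (fst c := (A (fst c))(reg s (snd c) := v))"

text \<open>The first argument of an instruction is its destination, except in \<open>VSet\<close>, which overwrites
  one component of a vector.\<close>

datatype instr =
    NConst nat nat
  | NAdd nat nat nat
  | NSub nat nat nat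
  | NLoad nat cell
  | NStore cell nat
  | ROfNat cell nat
  | RAdd cell cell cell
  | RSub cell cell cell
  | RMul cell cell cell
  | RPow cell cell nat
  | VGet cell cell nat
  | VSet cell nat cell
  | VAdd cell cell cell
  | VSub cell cell cell
  | VScale cell cell cell

fun step :: "instr \<Rightarrow> state \<Rightarrow> state" where
  "step (NConst r n) s = s\<lparr>reg := (reg s)(r := n)\<rparr>"
| "step (NAdd r r1 r2) s = s\<lparr>reg := (reg s)(r := reg s r1 + reg s r2)\<rparr>"
| "step (NSub r r1 r2) s = s\<lparr>reg := (reg s)(r := reg s r1 - reg s r2)\<rparr>"
| "step (NLoad r c) s = s\<lparr>reg := (reg s)(r := rd (narr s) s c)\<rparr>"
| "step (NStore c r) s = s\<lparr>narr := wr (narr s) s c (reg s r)\<rparr>"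
| "step (ROfNat d r) s = s\<lparr>rarr := wr (rarr s) s d (real (reg s r))\<rparr>"
| "step (RAdd d a b) s = s\<lparr>rarr := wr (rarr s) s d (rd (rarr s) s a + rd (rarr s) s b)\<rparr>"
| "step (RSub d a b) s = s\<lparr>rarr := wr (rarr s) s d (rd (rarr s) s a - rd (rarr s) s b)\<rparr>"
| "step (RMul d a b) s = s\<lparr>rarr := wr (rarr s) s d (rd (rarr s) s a * rd (rarr s) s b)\<rparr>"
| "step (RPow d a r) s = s\<lparr>rarr := wr (rarr s) s d (rd (rarr s) s a ^ reg s r)\<rparr>"
| "step (VGet d v r) s = s\<lparr>rarr := wr (rarr s) s d (rd (varr s) s v $ reg s r)\<rparr>"
| "step (VSet v r a) s =
     s\<lparr>varr := wr (varr s) s v (update_vec (rd (varr s) s v) (reg s r) (rd (rarr s) s a))\<rparr>"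
| "step (VAdd d u v) s = s\<lparr>varr := wr (varr s) s d (rd (varr s) s u + rd (varr s) s v)\<rparr>"
| "step (VSub d u v) s = s\<lparr>varr := wr (varr s) s d (rd (varr s) s u - rd (varr s) s v)\<rparr>"
| "step (VScale d a v) s = s\<lparr>varr := wr (varr s) s d (rd (rarr s) s a \<cdot>\<^sub>v rd (varr s) s v)\<rparr>"

fun is_vector_op :: "instr \<Rightarrow> bool" where
  "is_vector_op (VAdd _ _ _) = True"
| "is_vector_op (VSub _ _ _) = True"
| "is_vector_op (VScale _ _ _) = True"
| "is_vector_op _ = False"

datatype prog =
    Do instr
  | Seq prog prog
  | IfZero nat prog prog
  | Repeat nat prog

text \<open>The number of iterations of \<open>Repeat r c\<close> is the content of register \<open>r\<close> on entry to the loop.\<close>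

primrec run :: "prog \<Rightarrow> state \<Rightarrow> state" where
  "run (Do i) = step i"
| "run (Seq c1 c2) = (\<lambda>s. run c2 (run c1 s))"
| "run (IfZero r c1 c2) = (\<lambda>s. if reg s r = 0 then run c1 s else run c2 s)"
| "run (Repeat r c) = (\<lambda>s. (run c ^^ reg s r) s)"

text \<open>Every executed instruction is charged, including loads, stores, index arithmetic and
  tests; \<open>w\<close> is the price of a vector operation.\<close>

primrec cost :: "nat \<Rightarrow> prog \<Rightarrow> state \<Rightarrow> nat" where
  "cost w (Do i) = (\<lambda>s. if is_vector_op i then w else 1)"
| "cost w (Seq c1 c2) = (\<lambda>s. cost w c1 s + cost w c2 (run c1 s))"
| "cost w (IfZero r c1 c2) = (\<lambda>s. 1 + (if reg s r = 0 then cost w c1 s else cost w c2 s))"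
| "cost w (Repeat r c) = (\<lambda>s. 1 + (\<Sum>k<reg s r. 1 + cost w c ((run c ^^ k) s)))"

text \<open>An operation on \<open>m\<close>-dimensional vectors consists of \<open>m\<close> scalar operations.\<close>

definition scalar_ops :: "nat \<Rightarrow> prog \<Rightarrow> state \<Rightarrow> nat" where
  "scalar_ops m = cost m"

definition vector_ops :: "prog \<Rightarrow> state \<Rightarrow> nat" where
  "vector_ops = cost 1"

section \<open>Input and output\<close>

fun opcode :: "rule \<Rightarrow> nat" where
  "opcode (Add i j) = 0"
| "opcode (Sub i j) = 1"
| "opcode (Mul i j) = 2"
| "opcode (Pow i q) = 3"

fun arg1 :: "rule \<Rightarrow> nat" where
  "arg1 (Add i j) = i"
| "arg1 (Sub i j) = i"
| "arg1 (Mul i j) = i"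
| "arg1 (Pow i q) = i"

fun arg2 :: "rule \<Rightarrow> nat" where
  "arg2 (Add i j) = j"
| "arg2 (Sub i j) = j"
| "arg2 (Mul i j) = j"
| "arg2 (Pow i q) = q"

text \<open>The states in which a program may be started: the input is stored as described
  here, and everything else in memory is arbitrary.  The entries of the SLP are indexed by node number.\<close>

definition input_state :: "nat \<Rightarrow> slp \<Rightarrow> real vec \<Rightarrow> state \<Rightarrow> bool" where
  "input_state m P x s \<longleftrightarrow>
     reg s 0 = m \<and> reg s 1 = num_nodes m P \<and>
     (\<forall>k<length P. case P ! k of (\<alpha>, r) \<Rightarrow>
        narr s 0 (m + 1 + k) = opcode r \<and>
        narr s 1 (m + 1 + k) = arg1 r \<and>
        narr s 2 (m + 1 + k) = arg2 r \<and>
        rarr s 0 (m + 1 + k) = \<alpha>) \<and>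
     varr s 0 0 = x \<and>
     (\<forall>a i. varr s a i \<in> carrier_vec m)"

definition output_vec :: "state \<Rightarrow> real vec" where
  "output_vec s = varr s 1 0"

definition output_mat :: "nat \<Rightarrow> state \<Rightarrow> real mat" where
  "output_mat m s = mat_of_rows m (map (varr s 1) [0..<m])"

end

theory Submission
  imports Defs
begin

text \<open>Both parts are instances of reverse-mode automatic differentiation.  Write \<open>f\<^sub>l\<close> for the nodes
  and fix \<open>x\<close>.  If node \<open>l\<close> is computed from the nodes \<open>a\<close> and \<open>b\<close>, the chain rule gives coefficients with

    \<open>\<partial>\<^sub>j f\<^sub>l = c1 \<partial>\<^sub>j f\<^sub>a + c2 \<partial>\<^sub>j f\<^sub>b\<close> and

    \<open>\<partial>\<^sub>i \<partial>\<^sub>j f\<^sub>l = c1 \<partial>\<^sub>i \<partial>\<^sub>j f\<^sub>a + c2 \<partial>\<^sub>i \<partial>\<^sub>j f\<^sub>b + c11 \<partial>\<^sub>i f\<^sub>a \<partial>\<^sub>j f\<^sub>a + c12 (\<partial>\<^sub>i f\<^sub>a \<partial>\<^sub>j f\<^sub>b + \<partial>\<^sub>i f\<^sub>b \<partial>\<^sub>j f\<^sub>a)\<close>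

  (lemmas \<open>dnode_tape\<close> and \<open>ddnode_tape\<close>).  There is no coefficient for the second derivative with
  respect to \<open>b\<close>, because no rule is nonlinear in its second operand.  A first pass evaluates all nodes and
  stores \<open>a\<close>, \<open>b\<close> and the four coefficients of each node (\<open>linearize\<close>).

  For the gradient, scalars \<open>adj\<^sub>k\<close> (adjoints) start as 1 at the output node and 0 elsewhere.  For \<open>l\<close> from
  the last node down to \<open>m + 1\<close>, \<open>c1 adj\<^sub>l\<close> is added to \<open>adj\<^sub>a\<close> and \<open>c2 adj\<^sub>l\<close> to \<open>adj\<^sub>b\<close>.
  By the first recursion this keeps \<open>\<Sum>\<^bsub>k \<le> l\<^esub> adj\<^sub>k \<partial>\<^sub>j f\<^sub>k = \<partial>\<^sub>j p\<close> invariant while node \<open>l\<close> leaves the sum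
  (lemma \<open>grad_back_adj_inv\<close>).  Once only the constant and the inputs are left, the sum is the
  adjoint of \<open>x\<^sub>j\<close>.

  For the Hessian, the gradients \<open>\<nabla>f\<^sub>k\<close> are first computed by a forward pass with vector operations.
  The backward pass then carries a vector \<open>A\<^sub>k\<close> along with each \<open>adj\<^sub>k\<close>, initially 0 and updated by the
  product rule, so that \<open>A\<^sub>k\<close> stands for the gradient of \<open>adj\<^sub>k\<close>.  The second recursion shows that
  \<open>\<Sum>\<^bsub>k \<le> l\<^esub> (A\<^sub>k $ i \<partial>\<^sub>j f\<^sub>k + adj\<^sub>k \<partial>\<^sub>i \<partial>\<^sub>j f\<^sub>k) = \<partial>\<^sub>i \<partial>\<^sub>j p\<close> is invariant (lemma \<open>hess_back_adj_vec_inv\<close>).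
  At the end the vector of \<open>x\<^sub>j\<close> is column \<open>j\<close> of the Hessian; since partial derivatives of
  polynomial functions commute, it is also row \<open>j\<close>, the form in which the result is stored.

  All loops have at most \<open>N\<close> iterations with loop-free bodies, so the costs are bounded by constants
  times \<open>N\<close>.  Only the Hessian program uses vector operations, a bounded number per iteration.\<close>

section \<open>Polynomial functions and their partial derivatives\<close>

text \<open>The functions that are built from constants and coordinates by sums and products.  The last rule makes
  the notion depend only on the values on \<^term>\<open>carrier_vec m\<close>.\<close>

inductive poly_fun :: "nat \<Rightarrow> (real vec \<Rightarrow> real) \<Rightarrow> bool" for m where
  const: "poly_fun m (\<lambda>_. c)"
| coord: "k < m \<Longrightarrow> poly_fun m (\<lambda>x. x $ k)"
| add: "poly_fun m f \<Longrightarrow> poly_fun m g \<Longrightarrow> poly_fun m (\<lambda>x. f x + g x)"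
| mult: "poly_fun m f \<Longrightarrow> poly_fun m g \<Longrightarrow> poly_fun m (\<lambda>x. f x * g x)"
| cong: "poly_fun m f \<Longrightarrow> (\<And>x. x \<in> carrier_vec m \<Longrightarrow> g x = f x) \<Longrightarrow> poly_fun m g"

lemma poly_fun_power: "poly_fun m f \<Longrightarrow> poly_fun m (\<lambda>x. f x ^ q)"
  by (induction q) (auto intro: poly_fun.intros)

lemma partial_deriv_cong:
  assumes "x \<in> carrier_vec m" "\<And>y. y \<in> carrier_vec m \<Longrightarrow> f y = g y"
  shows "partial_deriv i f x = partial_deriv i g x"
proof -
  have "(\<lambda>t. f (x + t \<cdot>\<^sub>v unit_vec (dim_vec x) i)) = (\<lambda>t. g (x + t \<cdot>\<^sub>v unit_vec (dim_vec x) i))"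
    using assms by (intro ext assms(2)) auto
  then show ?thesis by (simp add: partial_deriv_def)
qed

lemma coord_along_line:
  fixes x :: "real vec"
  assumes "x \<in> carrier_vec m" "k < m"
  shows "(x + t \<cdot>\<^sub>v unit_vec (dim_vec x) i) $ k = x $ k + (if k = i then 1 else 0) * t"
  using assms by (auto simp: unit_vec_def)

lemma poly_fun_differentiable:
  assumes "poly_fun m f" "x \<in> carrier_vec m"
  shows "(\<lambda>t. f (x + t \<cdot>\<^sub>v unit_vec (dim_vec x) i)) field_differentiable at 0"
  using assms(1)
proof (induction rule: poly_fun.induct)
  case (coord k)
  then show ?case
    unfolding coord_along_line[OF assms(2) coord.hyps]
    by (intro derivative_intros)
next
  case (cong f g)
  have "(\<lambda>t. g (x + t \<cdot>\<^sub>v unit_vec (dim_vec x) i)) = (\<lambda>t. f (x + t \<cdot>\<^sub>v unit_vec (dim_vec x) i))"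
    using assms(2) by (intro ext cong.hyps) auto
  with cong.IH show ?case by simp
qed (auto intro!: derivative_intros)

lemma poly_fun_has_partial_deriv:
  assumes "poly_fun m f" "x \<in> carrier_vec m"
  shows "((\<lambda>t. f (x + t \<cdot>\<^sub>v unit_vec (dim_vec x) i)) has_real_derivative partial_deriv i f x) (at 0)"
  using poly_fun_differentiable[OF assms] 
  by (simp add: partial_deriv_def DERIV_deriv_iff_field_differentiable)

lemma partial_deriv_eqI:
  "((\<lambda>t. f (x + t \<cdot>\<^sub>v unit_vec (dim_vec x) i)) has_real_derivative d) (at 0) \<Longrightarrow> partial_deriv i f x = d"
  by (simp add: partial_deriv_def DERIV_imp_deriv)

lemma line_at_0: "x \<in> carrier_vec m \<Longrightarrow> x + 0 \<cdot>\<^sub>v unit_vec (dim_vec x) i = (x :: real vec)"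
  by (intro eq_vecI) auto

lemma partial_deriv_const: "partial_deriv i (\<lambda>_. c) x = 0"
  by (simp add: partial_deriv_def)

lemma partial_deriv_coord:
  assumes "x \<in> carrier_vec m" "k < m"
  shows "partial_deriv i (\<lambda>x. x $ k) x = (if k = i then 1 else 0)"
proof (rule partial_deriv_eqI)
  show "((\<lambda>t. (x + t \<cdot>\<^sub>v unit_vec (dim_vec x) i) $ k) has_real_derivative (if k = i then 1 else 0)) (at 0)"
    unfolding coord_along_line[OF assms] by (auto intro!: derivative_eq_intros)
qed

lemma partial_deriv_add:
  assumes "poly_fun m f" "poly_fun m g" "x \<in> carrier_vec m"
  shows "partial_deriv i (\<lambda>x. f x + g x) x = partial_deriv i f x + partial_deriv i g x"
  by (intro partial_deriv_eqI DERIV_add poly_fun_has_partial_deriv[of m] assms)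

lemma partial_deriv_mult:
  assumes "poly_fun m f" "poly_fun m g" "x \<in> carrier_vec m"
  shows "partial_deriv i (\<lambda>x. f x * g x) x = partial_deriv i f x * g x + f x * partial_deriv i g x"
  using DERIV_mult'[OF poly_fun_has_partial_deriv poly_fun_has_partial_deriv, OF assms(1,3) assms(2,3), of i i]
  by (intro partial_deriv_eqI) (simp add: line_at_0[OF assms(3)] algebra_simps)

lemma partial_deriv_cmult:
  assumes "poly_fun m f" "x \<in> carrier_vec m"
  shows "partial_deriv i (\<lambda>x. c * f x) x = c * partial_deriv i f x"
  using partial_deriv_mult[OF poly_fun.const assms] by (simp add: partial_deriv_const)

lemma partial_deriv_diff:
  assumes "poly_fun m f" "poly_fun m g" "x \<in> carrier_vec m"
  shows "partial_deriv i (\<lambda>x. f x - g x) x = partial_deriv i f x - partial_deriv i g x"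
  by (intro partial_deriv_eqI DERIV_diff poly_fun_has_partial_deriv[of m] assms)

lemma partial_deriv_power:
  assumes "poly_fun m f" "x \<in> carrier_vec m"
  shows "partial_deriv i (\<lambda>x. f x ^ q) x = real q * f x ^ (q - 1) * partial_deriv i f x"
  using DERIV_power[OF poly_fun_has_partial_deriv[OF assms], of i q]
  by (intro partial_deriv_eqI) (simp add: line_at_0[OF assms(2)] algebra_simps)

lemma poly_fun_partial_deriv:
  assumes "poly_fun m f"
  shows "poly_fun m (partial_deriv i f)"
  using assms
proof (induction rule: poly_fun.induct)
  case (const c)
  then show ?case by (rule poly_fun.cong[OF poly_fun.const]) (rule partial_deriv_const)
next
  case (coord k)
  then show ?case by (intro poly_fun.cong[OF poly_fun.const]) (rule partial_deriv_coord)
next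
  case (add f g)
  show ?case
    using poly_fun.add[OF add.IH] partial_deriv_add[OF add.hyps] by (rule poly_fun.cong)
next
  case (mult f g)
  show ?case
    using poly_fun.add[OF poly_fun.mult[OF mult.IH(1) mult.hyps(2)] poly_fun.mult[OF mult.hyps(1) mult.IH(2)]]
      partial_deriv_mult[OF mult.hyps]
    by (rule poly_fun.cong)
next
  case (cong f g)
  show ?case
    using cong.IH partial_deriv_cong[OF _ cong.hyps(2)] by (rule poly_fun.cong)
qed

lemma partial_deriv_commute:
  assumes "poly_fun m f" "x \<in> carrier_vec m"
  shows "partial_deriv i (partial_deriv j f) x = partial_deriv j (partial_deriv i f) x"
  using assms
proof (induction arbitrary: x rule: poly_fun.induct)
  case (const c)
  then show ?case by (simp add: partial_deriv_const[abs_def])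
next
  case (coord k)
  have "partial_deriv i (partial_deriv j (\<lambda>x. x $ k)) x = 0" for i j
    using partial_deriv_cong[OF coord.prems partial_deriv_coord[OF _ coord.hyps]]
    by (simp add: partial_deriv_const)
  then show ?case by simp
next
  case (add f g)
  have "partial_deriv i (partial_deriv j (\<lambda>x. f x + g x)) x
      = partial_deriv i (partial_deriv j f) x + partial_deriv i (partial_deriv j g) x" for i j
    using add.hyps add.prems
    by (subst partial_deriv_cong[OF add.prems partial_deriv_add[OF add.hyps]])
       (auto intro!: partial_deriv_add poly_fun_partial_deriv)
  then show ?case using add by simp
next
  case (mult f g)
  note pf = mult.hyps poly_fun_partial_deriv[OF mult.hyps(1)] poly_fun_partial_deriv[OF mult.hyps(2)]
  have "partial_deriv i (partial_deriv j (\<lambda>x. f x * g x)) x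
      = (partial_deriv i (partial_deriv j f) x * g x + partial_deriv j f x * partial_deriv i g x)
      + (partial_deriv i f x * partial_deriv j g x + f x * partial_deriv i (partial_deriv j g) x)" for i j
    by (subst partial_deriv_cong[OF mult.prems partial_deriv_mult[OF mult.hyps]])
       (simp_all add: partial_deriv_add[of m] partial_deriv_mult[of m] poly_fun.mult pf mult.prems)
  then show ?case using mult by simp
next
  case (cong f g)
  have "partial_deriv i (partial_deriv j g) x = partial_deriv i (partial_deriv j f) x" for i j
    by (rule partial_deriv_cong[OF cong.prems]) (rule partial_deriv_cong[OF _ cong.hyps(2)])
  then show ?case using cong by simp
qed

section \<open>The nodes of a straight-line program as functions\<close>

text \<open>The value of node \<open>k\<close> at \<open>x\<close>.\<close>

definition node :: "slp \<Rightarrow> nat \<Rightarrow> real vec \<Rightarrow> real" where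
  "node P k x = node_vals P x ! k"

lemma node_vals_snoc:
  "node_vals (P @ [c]) x = node_vals P x @ [fst c * rule_val (snd c) (node_vals P x)]"
  by (simp add: node_vals_def split: prod.splits)

lemma length_node_vals: "x \<in> carrier_vec m \<Longrightarrow> length (node_vals P x) = m + 1 + length P"
proof (induction P rule: rev_induct)
  case Nil
  then show ?case by (simp add: node_vals_def)
next
  case (snoc c P)
  then show ?case by (simp add: node_vals_snoc)
qed

lemma node_vals_append_nth:
  assumes "x \<in> carrier_vec m" "k < m + 1 + length P"
  shows "node_vals (P @ Q) x ! k = node_vals P x ! k"
proof (induction Q rule: rev_induct)
  case (snoc c Q)
  have "node_vals (P @ Q @ [c]) x = node_vals ((P @ Q) @ [c]) x" by simp
  with snoc show ?case using assms
    by (simp only: node_vals_snoc) (simp add: nth_append length_node_vals)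
qed simp

lemma node_0: "x \<in> carrier_vec m \<Longrightarrow> node P 0 x = 1"
  using node_vals_append_nth[of x m 0 "[]" P] by (simp add: node_def node_vals_def)

lemma node_input: "x \<in> carrier_vec m \<Longrightarrow> k < m \<Longrightarrow> node P (Suc k) x = x $ k"
  using node_vals_append_nth[of x m "Suc k" "[]" P]
  by (simp add: node_def node_vals_def nth_list_of_vec)

text \<open>The value of a rule when the values of the earlier nodes are given by a function instead of a list.\<close>

fun rule_val_fun :: "rule \<Rightarrow> (nat \<Rightarrow> real) \<Rightarrow> real" where
  "rule_val_fun (Add i j) f = f i + f j"
| "rule_val_fun (Sub i j) f = f i - f j"
| "rule_val_fun (Mul i j) f = f i * f j"
| "rule_val_fun (Pow i q) f = f i ^ q"

text \<open>The rule and the coefficient of node \<open>l\<close>, for \<open>l > m\<close>.\<close>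

abbreviation rule_of :: "nat \<Rightarrow> slp \<Rightarrow> nat \<Rightarrow> rule" where
  "rule_of m P l \<equiv> snd (P ! (l - Suc m))"
abbreviation coeff_of :: "nat \<Rightarrow> slp \<Rightarrow> nat \<Rightarrow> real" where
  "coeff_of m P l \<equiv> fst (P ! (l - Suc m))"

lemma node_computed:
  assumes "wf_slp m P" "x \<in> carrier_vec m" "m < l" "l < num_nodes m P"
  shows "node P l x = coeff_of m P l * rule_val_fun (rule_of m P l) (\<lambda>k. node P k x)"
proof -
  define k where "k = l - Suc m"
  have k: "k < length P" "l = m + 1 + k" using assms by (auto simp: k_def num_nodes_def)
  define Q where "Q = take k P"
  have Q: "length Q = k" "P = (Q @ [P ! k]) @ drop (Suc k) P" "P = Q @ drop k P"
    using k by (auto simp: Q_def id_take_nth_drop[symmetric])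
  have *: "node P i x = node_vals Q x ! i" if "i < l" for i
    unfolding node_def using node_vals_append_nth[OF assms(2), of i Q "drop k P"] that k Q by simp
  have "node P l x = node_vals (Q @ [P ! k]) x ! l"
    unfolding node_def using node_vals_append_nth[OF assms(2), of l "Q @ [P ! k]" "drop (Suc k) P"] k Q by simp
  also have "\<dots> = fst (P ! k) * rule_val (snd (P ! k)) (node_vals Q x)"
    using k Q assms(2) by (simp add: node_vals_snoc nth_append length_node_vals)
  also have "rule_val (snd (P ! k)) (node_vals Q x) = rule_val_fun (snd (P ! k)) (\<lambda>k. node P k x)"
  proof -
    have "\<forall>i\<in>operands (snd (P ! k)). i < l" using assms(1) k by (auto simp: wf_slp_def)
    then show ?thesis using * by (cases "snd (P ! k)") auto
  qed
  finally show ?thesis by (simp add: k_def)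
qed

lemma represents_node:
  assumes "represents m P p" "x \<in> carrier_vec m"
  shows "p x = node P (num_nodes m P - 1) x"
proof -
  have "node_vals P x \<noteq> []" using length_node_vals[OF assms(2), of P] by auto
  then show ?thesis using assms length_node_vals[OF assms(2), of P]
    by (auto simp: represents_def node_def last_conv_nth num_nodes_def)
qed

lemma poly_fun_rule:
  assumes "\<And>k. k \<in> operands r \<Longrightarrow> poly_fun m (f k)"
  shows "poly_fun m (\<lambda>x. \<alpha> * rule_val_fun r (\<lambda>k. f k x))"
proof -
  have "poly_fun m (\<lambda>x. f i x - f j x)" if "poly_fun m (f i)" "poly_fun m (f j)" for i j
    using poly_fun.add[OF that(1) poly_fun.mult[OF poly_fun.const[of _ "-1"] that(2)]] by simp
  then show ?thesis using assms
    by (cases r) (auto intro!: poly_fun.mult poly_fun.const poly_fun.add poly_fun_power)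
qed

lemma wf_operands:
  assumes "wf_slp m P" "m < l" "l < num_nodes m P" "k \<in> operands (rule_of m P l)"
  shows "k < l"
proof -
  have "l - Suc m < length P" using assms by (auto simp: num_nodes_def)
  then show ?thesis using assms by (auto simp: wf_slp_def dest!: spec[of _ "l - Suc m"])
qed

lemma poly_fun_node:
  assumes "wf_slp m P" "l < num_nodes m P"
  shows "poly_fun m (node P l)"
  using assms(2)
proof (induction l rule: less_induct)
  case (less l)
  consider "l = 0" | k where "k < m" "l = Suc k" | "m < l"
    by (metis Suc_lessI lessI not0_implies_Suc not_less_eq)
  then show ?case
  proof cases
    case 1
    then show ?thesis by (auto intro: poly_fun.cong[OF poly_fun.const] node_0)
  next
    case 2
    then show ?thesis by (auto intro: poly_fun.cong[OF poly_fun.coord] node_input)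
  next
    case 3
    have "poly_fun m (\<lambda>x. coeff_of m P l * rule_val_fun (rule_of m P l) (\<lambda>k. node P k x))"
      by (rule poly_fun_rule) (meson less wf_operands[OF assms(1) 3 less.prems] order.strict_trans)
    then show ?thesis by (rule poly_fun.cong) (rule node_computed[OF assms(1) _ 3 less.prems])
  qed
qed

section \<open>The chain rule for a single node\<close>

text \<open>The second operand of a rule.  A power has only one operand; node 0, the constant 1, serves as
  a second one, on which the value does not depend.\<close>

fun op2 :: "rule \<Rightarrow> nat" where
  "op2 (Add i j) = j"
| "op2 (Sub i j) = j"
| "op2 (Mul i j) = j"
| "op2 (Pow i q) = 0"

text \<open>The derivatives of \<open>\<alpha> * rule_val_fun r f\<close> with respect to the value of the first operand (\<open>d1\<close>) and of the
  second operand (\<open>d2\<close>), and its second derivatives with respect to the first operand twice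
  (\<open>d11\<close>) and to both operands (\<open>d12\<close>).  For powers the truncated subtraction in the exponents is harmless:
  whenever it takes effect, a factor in front is 0.\<close>

fun d1 :: "real \<Rightarrow> rule \<Rightarrow> (nat \<Rightarrow> real) \<Rightarrow> real" where
  "d1 \<alpha> (Add i j) f = \<alpha>"
| "d1 \<alpha> (Sub i j) f = \<alpha>"
| "d1 \<alpha> (Mul i j) f = \<alpha> * f j"
| "d1 \<alpha> (Pow i q) f = \<alpha> * real q * f i ^ (q - 1)"

fun d2 :: "real \<Rightarrow> rule \<Rightarrow> (nat \<Rightarrow> real) \<Rightarrow> real" where
  "d2 \<alpha> (Add i j) f = \<alpha>"
| "d2 \<alpha> (Sub i j) f = - \<alpha>"
| "d2 \<alpha> (Mul i j) f = \<alpha> * f i"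
| "d2 \<alpha> (Pow i q) f = 0"

fun d11 :: "real \<Rightarrow> rule \<Rightarrow> (nat \<Rightarrow> real) \<Rightarrow> real" where
  "d11 \<alpha> (Pow i q) f = \<alpha> * real q * real (q - 1) * f i ^ (q - 2)"
| "d11 \<alpha> _ f = 0"

fun d12 :: "real \<Rightarrow> rule \<Rightarrow> (nat \<Rightarrow> real) \<Rightarrow> real" where
  "d12 \<alpha> (Mul i j) f = \<alpha>"
| "d12 \<alpha> _ f = 0"

text \<open>First and second partial derivatives of node \<open>k\<close>.\<close>

definition dnode :: "slp \<Rightarrow> real vec \<Rightarrow> nat \<Rightarrow> nat \<Rightarrow> real" where
  "dnode P x k i = partial_deriv i (node P k) x"

definition ddnode :: "slp \<Rightarrow> real vec \<Rightarrow> nat \<Rightarrow> nat \<Rightarrow> nat \<Rightarrow> real" where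
  "ddnode P x k i j = partial_deriv i (partial_deriv j (node P k)) x"

lemma partial_deriv_rule:
  assumes pf: "\<And>k. k \<in> operands r \<Longrightarrow> poly_fun m (f k)" and x: "x \<in> carrier_vec m"
  shows "partial_deriv i (\<lambda>x. \<alpha> * rule_val_fun r (\<lambda>k. f k x)) x
     = d1 \<alpha> r (\<lambda>k. f k x) * partial_deriv i (f (arg1 r)) x
     + d2 \<alpha> r (\<lambda>k. f k x) * partial_deriv i (f (op2 r)) x"
proof -
  have "poly_fun m (\<lambda>x. rule_val_fun r (\<lambda>k. f k x))"
    using poly_fun_rule[of r m f 1] pf by simp
  then have "partial_deriv i (\<lambda>x. \<alpha> * rule_val_fun r (\<lambda>k. f k x)) x
     = \<alpha> * partial_deriv i (\<lambda>x. rule_val_fun r (\<lambda>k. f k x)) x"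
    using x by (rule partial_deriv_cmult)
  then show ?thesis using pf x
    by (cases r) (simp_all add: partial_deriv_add[of m] partial_deriv_diff[of m] partial_deriv_mult[of m]
        partial_deriv_power[of m] algebra_simps)
qed

lemma second_partial_deriv_rule:
  assumes pf: "\<And>k. k \<in> operands r \<Longrightarrow> poly_fun m (f k)" and x: "x \<in> carrier_vec m"
  defines "a \<equiv> f (arg1 r)" and "b \<equiv> f (op2 r)"
  shows "partial_deriv i (partial_deriv j (\<lambda>x. \<alpha> * rule_val_fun r (\<lambda>k. f k x))) x
     = d1 \<alpha> r (\<lambda>k. f k x) * partial_deriv i (partial_deriv j a) x
     + d2 \<alpha> r (\<lambda>k. f k x) * partial_deriv i (partial_deriv j b) x
     + d11 \<alpha> r (\<lambda>k. f k x) * (partial_deriv i a x * partial_deriv j a x)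
     + d12 \<alpha> r (\<lambda>k. f k x) * (partial_deriv i a x * partial_deriv j b x + partial_deriv i b x * partial_deriv j a x)"
proof -
  have eq: "partial_deriv i (partial_deriv j (\<lambda>x. \<alpha> * rule_val_fun r (\<lambda>k. f k x))) x
    = partial_deriv i (\<lambda>x. d1 \<alpha> r (\<lambda>k. f k x) * partial_deriv j a x + d2 \<alpha> r (\<lambda>k. f k x) * partial_deriv j b x) x"
    unfolding a_def b_def by (rule partial_deriv_cong[OF x partial_deriv_rule]) (use pf in auto)
  note rules = partial_deriv_add[of m] partial_deriv_diff[of m] partial_deriv_mult[of m] partial_deriv_cmult[of m]
        partial_deriv_power[of m] poly_fun_partial_deriv poly_fun.mult poly_fun.const poly_fun_power
        poly_fun_partial_deriv partial_deriv_const
  show ?thesis unfolding eq using pf x unfolding a_def b_def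
    by (cases r) (simp_all add: rules algebra_simps numeral_2_eq_2)
qed

lemma dnode_rec:
  assumes wf: "wf_slp m P" and x: "x \<in> carrier_vec m" and l: "m < l" "l < num_nodes m P"
  defines "r \<equiv> rule_of m P l" and "\<alpha> \<equiv> coeff_of m P l"
  shows "dnode P x l i = d1 \<alpha> r (\<lambda>k. node P k x) * dnode P x (arg1 r) i
     + d2 \<alpha> r (\<lambda>k. node P k x) * dnode P x (op2 r) i"
proof -
  have pf: "poly_fun m (node P k)" if "k \<in> operands r" for k
    using poly_fun_node[OF wf] wf_operands[OF wf l] that l unfolding r_def by (meson order.strict_trans)
  show ?thesis
    unfolding dnode_def
    by (subst partial_deriv_cong[OF x node_computed[OF wf _ l]]) (auto simp: r_def \<alpha>_def intro!: partial_deriv_rule x pf[unfolded r_def])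
qed

lemma ddnode_rec:
  assumes wf: "wf_slp m P" and x: "x \<in> carrier_vec m" and l: "m < l" "l < num_nodes m P"
  defines "r \<equiv> rule_of m P l" and "\<alpha> \<equiv> coeff_of m P l"
  defines "a \<equiv> arg1 r" and "b \<equiv> op2 r" and "f \<equiv> \<lambda>k. node P k x"
  shows "ddnode P x l i j = d1 \<alpha> r f * ddnode P x a i j + d2 \<alpha> r f * ddnode P x b i j
     + d11 \<alpha> r f * (dnode P x a i * dnode P x a j)
     + d12 \<alpha> r f * (dnode P x a i * dnode P x b j + dnode P x b i * dnode P x a j)"
proof -
  have pf: "poly_fun m (node P k)" if "k \<in> operands r" for k
    using poly_fun_node[OF wf] wf_operands[OF wf l] that l unfolding r_def by (meson order.strict_trans)
  have "ddnode P x l i j = partial_deriv i (partial_deriv j (\<lambda>x. \<alpha> * rule_val_fun r (\<lambda>k. node P k x))) x"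
    unfolding ddnode_def r_def \<alpha>_def
    by (rule partial_deriv_cong[OF x]) (rule partial_deriv_cong[OF _ node_computed[OF wf _ l]])
  then show ?thesis 
    using second_partial_deriv_rule[OF pf x] by (simp add: ddnode_def dnode_def f_def a_def b_def)
qed

lemma dnode_0: "x \<in> carrier_vec m \<Longrightarrow> dnode P x 0 i = 0"
  unfolding dnode_def by (subst partial_deriv_cong[OF _ node_0]) (auto simp: partial_deriv_const)

lemma dnode_input:
  "x \<in> carrier_vec m \<Longrightarrow> k < m \<Longrightarrow> dnode P x (Suc k) i = (if k = i then 1 else 0)"
  unfolding dnode_def
  by (subst partial_deriv_cong[OF _ node_input[where m = m]]) (auto simp: partial_deriv_coord)

text \<open>The initial nodes are affine.\<close>

lemma ddnode_initial:
  assumes "x \<in> carrier_vec m" "k \<le> m" 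
  shows "ddnode P x k i j = 0"
proof -
  have "\<exists>c. \<forall>y\<in>carrier_vec m. dnode P y k j = c"
    using assms dnode_0 dnode_input by (cases k) force+
  then obtain c where "\<And>y. y \<in> carrier_vec m \<Longrightarrow> partial_deriv j (node P k) y = c"
    by (auto simp: dnode_def)
  from partial_deriv_cong[OF assms(1) this] show ?thesis by (simp add: ddnode_def partial_deriv_const)
qed

lemma ddnode_commute:
  assumes "wf_slp m P" "x \<in> carrier_vec m" "k < num_nodes m P"
  shows "ddnode P x k i j = ddnode P x k j i"
  unfolding ddnode_def by (rule partial_deriv_commute[OF poly_fun_node[OF assms(1,3)] assms(2)])

lemma gradient_eq_dnode:
  assumes "represents m P p" "x \<in> carrier_vec m"
  shows "gradient m p x = vec m (dnode P x (num_nodes m P - 1))"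
  unfolding gradient_def dnode_def
  using partial_deriv_cong[OF assms(2) represents_node[OF assms(1)]] by simp

lemma hessian_eq_ddnode:
  assumes "represents m P p" "x \<in> carrier_vec m"
  shows "hessian m p x = mat m m (\<lambda>(i, j). ddnode P x (num_nodes m P - 1) i j)"
proof -
  have "partial_deriv i (partial_deriv j p) x = ddnode P x (num_nodes m P - 1) i j" for i j
    unfolding ddnode_def
    by (rule partial_deriv_cong[OF assms(2)]) (rule partial_deriv_cong[OF _ represents_node[OF assms(1)]])
  then show ?thesis by (simp add: hessian_def)
qed

section \<open>Correctness and cost of machine programs\<close>

text \<open>A nonempty sequence of instructions; nothing is said about the empty list.\<close>

fun block :: "instr list \<Rightarrow> prog" where
  "block [i] = Do i"
| "block (i # j # is) = Seq (Do i) (block (j # is))"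

text \<open>Loop-free programs have a bound on their cost that does not depend on the state: both branches of a test
  are counted.  The value for loops is irrelevant.\<close>

primrec loop_free :: "prog \<Rightarrow> bool" where
  "loop_free (Do i) = True"
| "loop_free (Seq c1 c2) = (loop_free c1 \<and> loop_free c2)"
| "loop_free (IfZero r c1 c2) = (loop_free c1 \<and> loop_free c2)"
| "loop_free (Repeat r c) = False"

primrec static_cost :: "nat \<Rightarrow> prog \<Rightarrow> nat" where
  "static_cost w (Do i) = (if is_vector_op i then w else 1)"
| "static_cost w (Seq c1 c2) = static_cost w c1 + static_cost w c2"
| "static_cost w (IfZero r c1 c2) = 1 + static_cost w c1 + static_cost w c2"
| "static_cost w (Repeat r c) = 0"

text \<open>The defining equations of \<^const>\<open>run\<close> and \<^const>\<open>cost\<close> rewrite unapplied programs to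
  abstractions over the state, so that a program would be executed symbolically on an unknown state, with
  all branches.  Equations for programs applied to a state avoid this.\<close>

declare run.simps [simp del] cost.simps [simp del]

lemma run_simps [simp]:
  "run (Do i) s = step i s"
  "run (Seq p q) s = run q (run p s)"
  "run (IfZero r p q) s = (if reg s r = 0 then run p s else run q s)"
  "run (Repeat r p) s = (run p ^^ reg s r) s"
  by (simp_all add: run.simps)

lemma cost_simps [simp]:
  "cost w (Do i) s = (if is_vector_op i then w else 1)"
  "cost w (Seq p q) s = cost w p s + cost w q (run p s)"
  "cost w (IfZero r p q) s = 1 + (if reg s r = 0 then cost w p s else cost w q s)"
  "cost w (Repeat r p) s = 1 + (\<Sum>k<reg s r. 1 + cost w p ((run p ^^ k) s))"
  by (simp_all add: cost.simps)

lemma cost_le_static: "loop_free c \<Longrightarrow> cost w c s \<le> static_cost w c"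
proof (induction c arbitrary: s)
  case (Seq c1 c2)
  then show ?case by (simp add: add_mono)
next
  case (IfZero r c1 c2)
  then show ?case by (auto intro: trans_le_add1 trans_le_add2)
qed auto

text \<open>A Hoare triple with a bound on the cost, where \<open>w\<close> is the price of a vector operation.\<close>

definition triple :: "nat \<Rightarrow> (state \<Rightarrow> bool) \<Rightarrow> prog \<Rightarrow> nat \<Rightarrow> (state \<Rightarrow> bool) \<Rightarrow> bool" where
  "triple w pre c n post \<longleftrightarrow> (\<forall>s. pre s \<longrightarrow> post (run c s) \<and> cost w c s \<le> n)"

lemma triple_Seq:
  "triple w pre c1 n1 mid \<Longrightarrow> triple w mid c2 n2 post \<Longrightarrow> triple w pre (Seq c1 c2) (n1 + n2) post"
  unfolding triple_def by (auto intro!: add_mono)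

lemma triple_loop_free:
  "loop_free c \<Longrightarrow> (\<And>s. pre s \<Longrightarrow> post (run c s)) \<Longrightarrow> triple w pre c (static_cost w c) post"
  unfolding triple_def by (auto intro: cost_le_static)

text \<open>\<open>Inv k\<close> holds after \<open>k\<close> iterations.\<close>

lemma triple_Repeat:
  assumes start: "\<And>s. pre s \<Longrightarrow> Inv 0 s \<and> reg s r = n"
    and lf: "loop_free c"
    and body: "\<And>k s. k < n \<Longrightarrow> Inv k s \<Longrightarrow> Inv (Suc k) (run c s)"
  shows "triple w pre (Repeat r c) (1 + n * (1 + static_cost w c)) (Inv n)"
  unfolding triple_def
proof (intro allI impI conjI)
  fix s assume "pre s"
  then have s: "Inv 0 s" "reg s r = n" using start by auto
  have "k \<le> n \<Longrightarrow> Inv k ((run c ^^ k) s)" for k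
    by (induction k) (use s body in auto)
  then show "Inv n (run (Repeat r c) s)" using s by simp
  have "(\<Sum>k<n. 1 + cost w c ((run c ^^ k) s)) \<le> (\<Sum>k<n. 1 + static_cost w c)"
    by (intro sum_mono add_left_mono cost_le_static lf)
  then show "cost w (Repeat r c) s \<le> 1 + n * (1 + static_cost w c)"
    using s by simp
qed

lemma triple_conseq_cost:
  "triple w pre c n post \<Longrightarrow> n \<le> n' \<Longrightarrow> (\<And>s. post s \<Longrightarrow> post' s) \<Longrightarrow> triple w pre c n' post'"
  unfolding triple_def by (meson order_trans)

section \<open>The programs\<close>

text \<open>Registers: 0 and 1 keep \<open>m\<close> and the number of nodes, 3 and 4 hold the constants 0 and 1, register 2 is the
  loop variable (mostly the current node \<open>l\<close>), 5 and 6 hold the operands of \<open>l\<close> (6 first the exponent, for a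
  power), 7 the opcode and later an exponent, 8 an exponent, and 9 a number of iterations.

  Arrays, indexed by node unless stated otherwise: the numbers \<open>narr 3\<close> are the second operands in the sense of \<^const>\<open>op2\<close>.
  The reals \<open>rarr 1\<close> are the values of the nodes, \<open>rarr 2\<close>, \<open>rarr 3\<close>, \<open>rarr 4\<close> and \<open>rarr 5\<close> the derivatives \<^const>\<open>d1\<close>,
  \<^const>\<open>d2\<close>, \<^const>\<open>d11\<close> and \<^const>\<open>d12\<close>, and \<open>rarr 6\<close> the adjoints.  The vectors \<open>varr 2\<close> are the gradients of
  the nodes and \<open>varr 3\<close> the gradients of the adjoints.  The entries 0 and 1 of \<open>rarr 7\<close> and entry 0 of
  \<open>varr 4\<close> hold intermediate results, and \<open>varr 1\<close> receives the output.  A real is copied by raising it to the power 1.\<close>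

text \<open>Stores the values of the initial nodes.\<close>

definition load_start :: prog where
  "load_start = block [NConst 3 0, NConst 4 1, NConst 2 0, ROfNat (1, 3) 4]"

definition load_body :: prog where
  "load_body = block [NAdd 5 2 4, VGet (1, 5) (0, 3) 2, NAdd 2 2 4]"

text \<open>Sets the loop variable to the first computed node and counts the computed nodes.  When it is executed, the
  loop variable is \<open>m\<close>.\<close>

definition lin_start :: prog where
  "lin_start = block [NAdd 2 2 4, NSub 9 1 2]"

text \<open>Evaluates node \<open>l\<close> and its derivatives.  The opcode is found by counting it down to 0.
  The case of a power uses entry \<open>l\<close> of \<open>rarr 3\<close> for intermediate results before it sets it to 0.
  In the case of a subtraction, \<open>- \<alpha>\<close> is computed as \<open>0 - \<alpha>\<close>, with the 0 that has just been stored in \<open>rarr 4\<close>.\<close>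

definition lin_body :: prog where
  "lin_body =
    Seq (block [NLoad 5 (1, 2), NLoad 6 (2, 2), NLoad 7 (0, 2),
                NStore (3, 2) 6, ROfNat (4, 2) 3, ROfNat (5, 2) 3])
   (Seq (IfZero 7
          (block [RAdd (1, 2) (1, 5) (1, 6),
                  RPow (2, 2) (0, 2) 4, RPow (3, 2) (0, 2) 4])
   (Seq (Do (NSub 7 7 4)) (IfZero 7
          (block [RSub (1, 2) (1, 5) (1, 6),
                  RPow (2, 2) (0, 2) 4, RSub (3, 2) (4, 2) (0, 2)])
   (Seq (Do (NSub 7 7 4)) (IfZero 7
          (block [RMul (1, 2) (1, 5) (1, 6),
                  RMul (2, 2) (0, 2) (1, 6), RMul (3, 2) (0, 2) (1, 5), RPow (5, 2) (0, 2) 4])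
          (block [RPow (1, 2) (1, 5) 6,
                  NSub 8 6 4, NSub 7 8 4,
                  ROfNat (2, 2) 6, RMul (2, 2) (0, 2) (2, 2),
                  ROfNat (4, 2) 8, RMul (4, 2) (2, 2) (4, 2),
                  RPow (3, 2) (1, 5) 8, RMul (2, 2) (2, 2) (3, 2),
                  RPow (3, 2) (1, 5) 7, RMul (4, 2) (4, 2) (3, 2),
                  ROfNat (3, 2) 3, NStore (3, 2) 3]))))))
   (block [RMul (1, 2) (0, 2) (1, 2), NAdd 2 2 4]))"

definition linearize :: prog where
  "linearize = Seq (Seq load_start (Repeat 0 load_body)) (Seq lin_start (Repeat 9 lin_body))"

definition zero_adj_body :: prog where
  "zero_adj_body = block [ROfNat (6, 2) 3, NAdd 2 2 4]"

text \<open>Sets the adjoint of the output node to 1 and the loop variable to that node.\<close>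

definition seed :: prog where
  "seed = block [NSub 2 1 4, ROfNat (6, 2) 4, NSub 9 1 0, NSub 9 9 4]"

text \<open>Distributes the adjoint of node \<open>l\<close> to its operands.  The second addition reads the result of the first,
  so equal operands are allowed.\<close>

definition grad_back_body :: prog where
  "grad_back_body = block [NLoad 5 (1, 2), NLoad 6 (3, 2),
     RMul (7, 3) (2, 2) (6, 2), RAdd (6, 5) (6, 5) (7, 3),
     RMul (7, 3) (3, 2) (6, 2), RAdd (6, 6) (6, 6) (7, 3), NSub 2 2 4]"

definition grad_out_body :: prog where
  "grad_out_body = block [NAdd 5 2 4, VSet (1, 3) 2 (6, 5), NAdd 2 2 4]"

definition gradient_prog :: prog where
  "gradient_prog =
     Seq linearize
    (Seq (Seq (Do (NConst 2 0)) (Repeat 1 zero_adj_body))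
    (Seq (Seq seed (Repeat 9 grad_back_body))
         (Seq (Do (NConst 2 0)) (Repeat 0 grad_out_body))))"

text \<open>A zero vector is obtained as the difference of a vector with itself, whatever the memory contains.\<close>

definition zero_vec_body :: prog where
  "zero_vec_body = block [VSub (2, 2) (2, 2) (2, 2), VSub (3, 2) (3, 2) (3, 2), ROfNat (6, 2) 3, NAdd 2 2 4]"

definition unit_body :: prog where
  "unit_body = block [NAdd 5 2 4, VSet (2, 5) 2 (7, 3), NAdd 2 2 4]"

definition tangent_body :: prog where
  "tangent_body = block [NLoad 5 (1, 2), NLoad 6 (3, 2),
     VScale (2, 2) (2, 2) (2, 5), VScale (4, 3) (3, 2) (2, 6), VAdd (2, 2) (2, 2) (4, 3), NAdd 2 2 4]"

text \<open>With \<open>A\<close> for \<open>varr 3\<close> and \<open>D\<close> for \<open>varr 2\<close>, and \<open>a\<close>, \<open>b\<close> for the operands of \<open>l\<close>: adds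
  \<open>c1 A\<^sub>l + adj\<^sub>l (c11 D\<^sub>a + c12 D\<^sub>b)\<close> to \<open>A\<^sub>a\<close> and \<open>c2 A\<^sub>l + adj\<^sub>l c12 D\<^sub>a\<close> to \<open>A\<^sub>b\<close>.  These are the gradients of the scalar
  updates \<open>c1 adj\<^sub>l\<close> and \<open>c2 adj\<^sub>l\<close>, by the product rule.\<close>

definition hess_back_vec :: prog where
  "hess_back_vec = block [NLoad 5 (1, 2), NLoad 6 (3, 2),
     RMul (7, 3) (4, 2) (6, 2), RMul (7, 4) (5, 2) (6, 2),
     VScale (4, 3) (2, 2) (3, 2), VAdd (3, 5) (3, 5) (4, 3),
     VScale (4, 3) (7, 3) (2, 5), VAdd (3, 5) (3, 5) (4, 3),
     VScale (4, 3) (7, 4) (2, 6), VAdd (3, 5) (3, 5) (4, 3),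
     VScale (4, 3) (3, 2) (3, 2), VAdd (3, 6) (3, 6) (4, 3),
     VScale (4, 3) (7, 4) (2, 5), VAdd (3, 6) (3, 6) (4, 3)]"

definition hess_back_body :: prog where
  "hess_back_body = Seq hess_back_vec grad_back_body"

text \<open>Copies vectors by scaling them by 1.\<close>

definition hess_out_body :: prog where
  "hess_out_body = block [NAdd 5 2 4, VScale (1, 2) (7, 3) (3, 5), NAdd 2 2 4]"

definition hessian_prog :: prog where
  "hessian_prog =
     Seq linearize
    (Seq (Seq (Do (NConst 2 0)) (Repeat 1 zero_vec_body))
    (Seq (Seq (block [NConst 2 0, ROfNat (7, 3) 4]) (Repeat 0 unit_body))
    (Seq (Seq lin_start (Repeat 9 tangent_body))
    (Seq (Seq seed (Repeat 9 hess_back_body))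
         (Seq (block [NConst 2 0, ROfNat (7, 3) 4]) (Repeat 0 hess_out_body))))))"

section \<open>Evaluation and linearization\<close>

text \<open>A well-formed straight-line program and a point at which it is evaluated.\<close>

locale slp_point =
  fixes m :: nat and P :: slp and x :: "real vec"
  assumes wf: "wf_slp m P" and x: "x \<in> carrier_vec m"
begin

abbreviation "N \<equiv> num_nodes m P"
abbreviation "val k \<equiv> node P k x"

text \<open>The derivatives and operands at the computed node \<open>l\<close>.\<close>

definition "c1 l = d1 (coeff_of m P l) (rule_of m P l) (\<lambda>k. node P k x)"
definition "c2 l = d2 (coeff_of m P l) (rule_of m P l) (\<lambda>k. node P k x)"
definition "c11 l = d11 (coeff_of m P l) (rule_of m P l) (\<lambda>k. node P k x)"
definition "c12 l = d12 (coeff_of m P l) (rule_of m P l) (\<lambda>k. node P k x)"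
definition "fst_op l = arg1 (rule_of m P l)"
definition "snd_op l = op2 (rule_of m P l)"

lemmas local_defs = c1_def c2_def c11_def c12_def fst_op_def snd_op_def

lemma dnode_tape:
  assumes "m < l" "l < N"
  shows "dnode P x l i = c1 l * dnode P x (fst_op l) i + c2 l * dnode P x (snd_op l) i"
  using dnode_rec[OF wf x assms] by (simp add: local_defs)

lemma ddnode_tape:
  assumes "m < l" "l < N"
  shows "ddnode P x l i j = c1 l * ddnode P x (fst_op l) i j + c2 l * ddnode P x (snd_op l) i j
     + c11 l * (dnode P x (fst_op l) i * dnode P x (fst_op l) j)
     + c12 l * (dnode P x (fst_op l) i * dnode P x (snd_op l) j + dnode P x (snd_op l) i * dnode P x (fst_op l) j)"
  using ddnode_rec[OF wf x assms] by (simp add: local_defs)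

lemma ops_less:
  assumes "m < l" "l < N" shows "fst_op l < l" "snd_op l < l"
proof -
  note * = wf_operands[OF wf assms]
  show "fst_op l < l" by (cases "rule_of m P l") (auto simp: local_defs intro: *)
  show "snd_op l < l" by (cases "rule_of m P l") (use assms in \<open>auto simp: local_defs intro: *\<close>)
qed

text \<open>What holds in memory throughout, once the constants 0 and 1 have been loaded.\<close>

definition base :: "state \<Rightarrow> bool" where
  "base s \<longleftrightarrow> reg s 0 = m \<and> reg s 1 = N \<and> reg s 3 = 0 \<and> reg s 4 = 1 \<and> (\<forall>a i. varr s a i \<in> carrier_vec m)"

definition program_in :: "state \<Rightarrow> bool" where
  "program_in s \<longleftrightarrow> (\<forall>l. m < l \<and> l < N \<longrightarrow>
     narr s 0 l = opcode (rule_of m P l) \<and> narr s 1 l = arg1 (rule_of m P l) \<and>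
     narr s 2 l = arg2 (rule_of m P l) \<and> rarr s 0 l = coeff_of m P l)"

definition vals_upto :: "nat \<Rightarrow> state \<Rightarrow> bool" where
  "vals_upto n s \<longleftrightarrow> (\<forall>l<n. rarr s 1 l = val l)"

definition tape_entry :: "state \<Rightarrow> nat \<Rightarrow> bool" where
  "tape_entry s l \<longleftrightarrow> narr s 1 l = fst_op l \<and> narr s 3 l = snd_op l \<and>
     rarr s 2 l = c1 l \<and> rarr s 3 l = c2 l \<and> rarr s 4 l = c11 l \<and> rarr s 5 l = c12 l"

definition tape_upto :: "nat \<Rightarrow> state \<Rightarrow> bool" where
  "tape_upto n s \<longleftrightarrow> (\<forall>l. m < l \<and> l < n \<longrightarrow> tape_entry s l)"

text \<open>The result of the first pass, and all that the later passes need.\<close>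

definition taped :: "state \<Rightarrow> bool" where
  "taped s \<longleftrightarrow> base s \<and> tape_upto N s"

lemma input_program_in:
  assumes "input_state m P x s" shows "program_in s"
  unfolding program_in_def
proof (intro allI impI)
  fix l assume l: "m < l \<and> l < N"
  then have k: "l - Suc m < length P" "m + 1 + (l - Suc m) = l" by (auto simp: num_nodes_def)
  have "\<forall>k<length P. case P ! k of (\<alpha>, r) \<Rightarrow>
        narr s 0 (m + 1 + k) = opcode r \<and> narr s 1 (m + 1 + k) = arg1 r \<and>
        narr s 2 (m + 1 + k) = arg2 r \<and> rarr s 0 (m + 1 + k) = \<alpha>"
    using assms by (simp add: input_state_def)
  from this[rule_format, OF k(1)] show "narr s 0 l = opcode (rule_of m P l) \<and> narr s 1 l = arg1 (rule_of m P l) \<and>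
     narr s 2 l = arg2 (rule_of m P l) \<and> rarr s 0 l = coeff_of m P l"
    unfolding k(2) by (simp split: prod.splits)
qed

lemma load_triple:
  "triple w (input_state m P x) (Seq load_start (Repeat 0 load_body))
     (5 + m * 4)
     (\<lambda>s. base s \<and> program_in s \<and> reg s 2 = m \<and> vals_upto (Suc m) s)"
proof -
  define I where "I k s \<longleftrightarrow> base s \<and> program_in s \<and> varr s 0 0 = x \<and> reg s 2 = k \<and> vals_upto (Suc k) s" for k s
  have "triple w (input_state m P x) load_start (static_cost w load_start) (I 0)"
  proof (rule triple_loop_free)
    fix s assume s: "input_state m P x s"
    show "I 0 (run load_start s)" using input_program_in[OF s] s node_0[OF x, of P]
      by (simp add: I_def load_start_def base_def program_in_def vals_upto_def rd_def wr_def input_state_def)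
  qed (simp add: load_start_def)
  moreover have "triple w (I 0) (Repeat 0 load_body) (1 + m * (1 + static_cost w load_body)) (I m)"
  proof (rule triple_Repeat)
    fix k s assume "k < m" "I k s"
    then show "I (Suc k) (run load_body s)"
      using node_input[OF x, of k P]
      by (auto simp: I_def load_body_def base_def program_in_def vals_upto_def rd_def wr_def less_Suc_eq)
  qed (auto simp: I_def base_def load_body_def)
  ultimately have "triple w (input_state m P x) (Seq load_start (Repeat 0 load_body))
     (static_cost w load_start + (1 + m * (1 + static_cost w load_body))) (I m)"
    by (rule triple_Seq)
  then show ?thesis
    by (rule triple_conseq_cost) (auto simp: I_def load_start_def load_body_def)
qed

lemma lin_triple:
  "triple w (\<lambda>s. base s \<and> program_in s \<and> reg s 2 = m \<and> vals_upto (Suc m) s)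
     (Seq lin_start (Repeat 9 lin_body)) (3 + length P * (1 + static_cost w lin_body)) taped"
proof -
  define I where "I k s \<longleftrightarrow> base s \<and> program_in s \<and> reg s 2 = Suc (m + k) \<and>
     vals_upto (Suc (m + k)) s \<and> tape_upto (Suc (m + k)) s" for k s
  have "triple w (\<lambda>s. base s \<and> program_in s \<and> reg s 2 = m \<and> vals_upto (Suc m) s) lin_start
     (static_cost w lin_start) (\<lambda>s. I 0 s \<and> reg s 9 = length P)"
    by (rule triple_loop_free)
      (auto simp: I_def lin_start_def base_def program_in_def vals_upto_def tape_upto_def num_nodes_def)
  moreover have "triple w (\<lambda>s. I 0 s \<and> reg s 9 = length P) (Repeat 9 lin_body)
      (1 + length P * (1 + static_cost w lin_body)) (I (length P))"
  proof (rule triple_Repeat)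
    fix k s assume k: "k < length P" and I: "I k s"
    define l where "l = Suc (m + k)"
    have l: "m < l" "l < N" using k by (auto simp: l_def num_nodes_def)
    define r where "r = rule_of m P l"
    define \<alpha> where "\<alpha> = coeff_of m P l"
    note ops = wf_operands[OF wf l, folded r_def]
    have val: "val l = \<alpha> * rule_val_fun r (\<lambda>k. val k)"
      using node_computed[OF wf x l] by (simp add: r_def \<alpha>_def)
    have s: "reg s 0 = m" "reg s (Suc 0) = N" "reg s 3 = 0" "reg s 4 = 1" "reg s 2 = l"
      "\<And>a i. varr s a i \<in> carrier_vec m" 
      "narr s 0 l = opcode r" "narr s (Suc 0) l = arg1 r" "narr s 2 l = arg2 r" "rarr s 0 l = \<alpha>"
      "\<And>i. i < l \<Longrightarrow> rarr s (Suc 0) i = val i"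
      using I l by (auto simp: I_def l_def[symmetric] base_def program_in_def vals_upto_def r_def \<alpha>_def)
    define s' where "s' = run lin_body s"
    have step: "reg s' 0 = m \<and> reg s' (Suc 0) = N \<and> reg s' 3 = 0 \<and> reg s' 4 = 1 \<and> reg s' 2 = Suc l \<and>
      varr s' = varr s \<and> narr s' = (narr s)(3 := (narr s 3)(l := op2 r)) \<and>
      rarr s' 0 = rarr s 0 \<and> rarr s' 1 = (rarr s 1)(l := val l) \<and>
      rarr s' 2 = (rarr s 2)(l := d1 \<alpha> r (\<lambda>k. val k)) \<and> rarr s' 3 = (rarr s 3)(l := d2 \<alpha> r (\<lambda>k. val k)) \<and>
      rarr s' 4 = (rarr s 4)(l := d11 \<alpha> r (\<lambda>k. val k)) \<and> rarr s' 5 = (rarr s 5)(l := d12 \<alpha> r (\<lambda>k. val k))"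
    proof (cases r)
      case (Add i j)
      have "i < l" "j < l" "i \<noteq> l" "j \<noteq> l" using ops Add by auto
      then show ?thesis using s val Add unfolding s'_def lin_body_def
        by (simp add: rd_def wr_def)
    next
      case (Sub i j)
      have "i < l" "j < l" "i \<noteq> l" "j \<noteq> l" using ops Sub by auto
      then show ?thesis using s val Sub unfolding s'_def lin_body_def
        by (simp add: rd_def wr_def)
    next
      case (Mul i j)
      have "i < l" "j < l" "i \<noteq> l" "j \<noteq> l" using ops Mul by auto
      then show ?thesis using s val Mul unfolding s'_def lin_body_def
        by (simp add: rd_def wr_def)
    next
      case (Pow i q)
      have "i < l" "i \<noteq> l" using ops Pow by auto
      then show ?thesis using s val Pow unfolding s'_def lin_body_def
        by (simp add: rd_def wr_def algebra_simps numeral_2_eq_2)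
    qed
    have "I (Suc k) s'"
      using I step l unfolding I_def l_def[symmetric] add_Suc_right
      by (auto simp: base_def program_in_def vals_upto_def tape_upto_def tape_entry_def local_defs r_def \<alpha>_def less_Suc_eq)
    then show "I (Suc k) (run lin_body s)" by (simp add: s'_def)
  qed (auto simp: lin_body_def)
  ultimately have "triple w (\<lambda>s. base s \<and> program_in s \<and> reg s 2 = m \<and> vals_upto (Suc m) s)
     (Seq lin_start (Repeat 9 lin_body))
     (static_cost w lin_start + (1 + length P * (1 + static_cost w lin_body))) (I (length P))"
    by (rule triple_Seq)
  then show ?thesis
    by (rule triple_conseq_cost) (auto simp: I_def taped_def num_nodes_def lin_start_def)
qed

lemma linearize_triple:
  "triple w (input_state m P x) linearize
     (5 + m * 4 + (3 + length P * (1 + static_cost w lin_body))) taped"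
  unfolding linearize_def by (rule triple_Seq[OF load_triple lin_triple])

section \<open>The backward pass for the gradient\<close>

lemma taped_entry:
  assumes "taped s" "m < l" "l < N"
  shows "narr s 1 l = fst_op l" "narr s (Suc 0) l = fst_op l" "narr s 3 l = snd_op l"
     "rarr s 2 l = c1 l" "rarr s 3 l = c2 l" "rarr s 4 l = c11 l" "rarr s 5 l = c12 l"
  using assms by (auto simp: taped_def tape_upto_def tape_entry_def)

lemma taped_base:
  assumes "taped s"
  shows "reg s 0 = m" "reg s 1 = N" "reg s (Suc 0) = N" "reg s 3 = 0" "reg s 4 = 1"
    "varr s a i \<in> carrier_vec m" "dim_vec (varr s a i) = m"
  using assms by (auto simp: taped_def base_def)

lemma tapedI:
  assumes "taped s" "reg s' 0 = m" "reg s' 1 = N" "reg s' 3 = 0" "reg s' 4 = 1"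
    "\<And>a i. varr s' a i \<in> carrier_vec m"
    "narr s' = narr s" "rarr s' 2 = rarr s 2" "rarr s' 3 = rarr s 3"
    "rarr s' 4 = rarr s 4" "rarr s' 5 = rarr s 5"
  shows "taped s'"
  using assms by (auto simp: taped_def base_def tape_upto_def tape_entry_def)

lemma update_vec_carrier: "v \<in> carrier_vec n \<Longrightarrow> update_vec v i a \<in> carrier_vec n"
  by (rule carrier_vecI) simp

lemma taped_set_reg:
  "taped s \<Longrightarrow> r \<notin> {0, 1, 3, 4} \<Longrightarrow> taped (s\<lparr>reg := (reg s)(r := v)\<rparr>)"
  by (rule tapedI[of s]) (auto simp: taped_base)

text \<open>The update by which adjoints are accumulated.\<close>

definition bump :: "(nat \<Rightarrow> real) \<Rightarrow> nat \<Rightarrow> real \<Rightarrow> nat \<Rightarrow> real" where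
  "bump a i u = a(i := a i + u)"

lemma sum_bump:
  assumes "finite S" "i \<in> S"
  shows "(\<Sum>k\<in>S. bump a i u k * g k) = (\<Sum>k\<in>S. a k * g k) + u * g i"
proof -
  have "(\<Sum>k\<in>S. bump a i u k * g k) = (\<Sum>k\<in>S. a k * g k + (if k = i then u * g i else 0))"
    by (intro sum.cong) (auto simp: bump_def algebra_simps)
  then show ?thesis using assms by (simp add: sum.distrib)
qed

text \<open>The invariants of the backward passes for the gradient (\<open>adj_inv\<close>) and the Hessian (\<open>adj_vec_inv\<close>), when the
  nodes after \<open>l\<close> have been processed.\<close>

definition adj_inv :: "nat \<Rightarrow> state \<Rightarrow> bool" where
  "adj_inv l s \<longleftrightarrow> (\<forall>j<m. (\<Sum>k\<le>l. rarr s 6 k * dnode P x k j) = dnode P x (N - 1) j)"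

definition adj_vec_inv :: "nat \<Rightarrow> state \<Rightarrow> bool" where
  "adj_vec_inv l s \<longleftrightarrow> (\<forall>i<m. \<forall>j<m.
     (\<Sum>k\<le>l. varr s 3 k $ i * dnode P x k j) + (\<Sum>k\<le>l. rarr s 6 k * ddnode P x k i j)
       = ddnode P x (N - 1) i j)"

text \<open>The gradients of the nodes below \<open>n\<close> are in memory.\<close>

definition tangents_upto :: "nat \<Rightarrow> state \<Rightarrow> bool" where
  "tangents_upto n s \<longleftrightarrow> (\<forall>l<n. \<forall>i<m. varr s 2 l $ i = dnode P x l i)"

lemma grad_back_effect:
  assumes s: "taped s" and l: "reg s 2 = l" "m < l" "l < N"
  shows "taped (run grad_back_body s)"
    "reg (run grad_back_body s) 2 = l - 1"
    "varr (run grad_back_body s) = varr s"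
    "rarr (run grad_back_body s) 6 =
       bump (bump (rarr s 6) (fst_op l) (c1 l * rarr s 6 l)) (snd_op l) (c2 l * rarr s 6 l)"
proof -
  have less: "fst_op l < l" "snd_op l < l" "fst_op l \<noteq> l" "snd_op l \<noteq> l"
    using ops_less[OF l(2,3)] by auto
  note simps = grad_back_body_def rd_def wr_def bump_def taped_base[OF s] taped_entry[OF s l(2,3)] l(1) less
  show "taped (run grad_back_body s)" by (rule tapedI[OF s]) (simp_all add: simps)
  show "reg (run grad_back_body s) 2 = l - 1" by (simp add: simps)
  show "varr (run grad_back_body s) = varr s" by (simp add: simps)
  show "rarr (run grad_back_body s) 6 =
       bump (bump (rarr s 6) (fst_op l) (c1 l * rarr s 6 l)) (snd_op l) (c2 l * rarr s 6 l)" 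
    using less(3,4)[symmetric] by (simp add: simps)
qed

lemma grad_back_adj_inv:
  assumes "taped s" "reg s 2 = l" "m < l" "l < N" "adj_inv l s"
  shows "adj_inv (l - 1) (run grad_back_body s)"
  unfolding adj_inv_def
proof (intro allI impI)
  fix j assume "j < m"
  obtain n where n: "l = Suc n" using assms(3) by (cases l) auto
  then have ln: "l - 1 = n" by simp
  have less: "fst_op l \<in> {..n}" "snd_op l \<in> {..n}" using ops_less[OF assms(3,4)] n by auto
  let ?g = "\<lambda>k. dnode P x k j"
  have "(\<Sum>k\<le>l - 1. rarr (run grad_back_body s) 6 k * ?g k)
      = (\<Sum>k\<le>n. rarr s 6 k * ?g k) + c1 l * rarr s 6 l * ?g (fst_op l) + c2 l * rarr s 6 l * ?g (snd_op l)"
    by (simp only: grad_back_effect(4)[OF assms(1-4)] ln sum_bump[OF _ less(1)] sum_bump[OF _ less(2)] finite_atMost)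
  \<comment> \<open>The two new terms are the contribution of node \<open>l\<close>, by the chain rule.\<close>
  also have "\<dots> = (\<Sum>k\<le>n. rarr s 6 k * ?g k) + rarr s 6 l * ?g l"
    by (simp add: dnode_tape[OF assms(3,4)] algebra_simps)
  also have "\<dots> = (\<Sum>k\<le>l. rarr s 6 k * ?g k)"
    by (simp add: n)
  finally show "(\<Sum>k\<le>l - 1. rarr (run grad_back_body s) 6 k * ?g k) = dnode P x (N - 1) j"
    using assms(5) \<open>j < m\<close> by (simp add: adj_inv_def)
qed

lemma zero_adj_triple:
  "triple w taped (Seq (Do (NConst 2 0)) (Repeat 1 zero_adj_body))
     (2 + N * 3) (\<lambda>s. taped s \<and> (\<forall>l<N. rarr s 6 l = 0))"
proof -
  define I where "I k s \<longleftrightarrow> taped s \<and> reg s 2 = k \<and> (\<forall>l<k. rarr s 6 l = 0)" for k s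
  have "triple w taped (Do (NConst 2 0)) (static_cost w (Do (NConst 2 0))) (I 0)"
    by (rule triple_loop_free) (auto simp: I_def taped_set_reg)
  moreover have "triple w (I 0) (Repeat 1 zero_adj_body) (1 + N * (1 + static_cost w zero_adj_body)) (I N)"
  proof (rule triple_Repeat)
    fix k s assume "k < N" "I k s"
    then have s: "taped s" "reg s 2 = k" "\<And>l. l < k \<Longrightarrow> rarr s 6 l = 0" by (auto simp: I_def)
    have "taped (run zero_adj_body s)"
      by (rule tapedI[OF s(1)]) (simp_all add: zero_adj_body_def taped_base[OF s(1)] rd_def wr_def)
    then show "I (Suc k) (run zero_adj_body s)"
      using s by (auto simp: I_def zero_adj_body_def taped_base[OF s(1)] rd_def wr_def less_Suc_eq)
  qed (auto simp: I_def zero_adj_body_def taped_base)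
  ultimately show ?thesis
    by (rule triple_conseq_cost[OF triple_Seq]) (auto simp: I_def zero_adj_body_def)
qed

lemma sum_seeded:
  fixes g :: "nat \<Rightarrow> real"
  assumes "\<And>l. l < N \<Longrightarrow> a l = (if l = N - 1 then 1 else 0)"
  shows "(\<Sum>k\<le>N - 1. a k * g k) = g (N - 1)"
proof -
  have "(\<Sum>k\<le>N - 1. a k * g k) = (\<Sum>k\<le>N - 1. if k = N - 1 then g k else 0)"
    by (intro sum.cong) (use assms in \<open>auto simp: num_nodes_def\<close>)
  then show ?thesis by simp
qed

lemma seed_effect:
  assumes s: "taped s" "\<And>l. l < N \<Longrightarrow> rarr s 6 l = 0"
  shows "taped (run seed s)" "reg (run seed s) 2 = N - 1" "reg (run seed s) 9 = length P"
    "varr (run seed s) = varr s" "adj_inv (N - 1) (run seed s)"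
    "(\<Sum>k\<le>N - 1. rarr (run seed s) 6 k * g k) = g (N - 1)"
proof -
  show "taped (run seed s)"
    by (rule tapedI[OF s(1)]) (simp_all add: seed_def taped_base[OF s(1)] rd_def wr_def)
  show "reg (run seed s) 2 = N - 1" "reg (run seed s) 9 = length P" "varr (run seed s) = varr s"
    by (simp_all add: seed_def taped_base[OF s(1)] rd_def wr_def num_nodes_def)
  have *: "rarr (run seed s) 6 l = (if l = N - 1 then 1 else 0)" if "l < N" for l
    using s(2)[OF that] by (simp add: seed_def taped_base[OF s(1)] rd_def wr_def)
  show "(\<Sum>k\<le>N - 1. rarr (run seed s) 6 k * g k) = g (N - 1)" for g
    by (rule sum_seeded[OF *])
  then show "adj_inv (N - 1) (run seed s)" by (simp add: adj_inv_def)
qed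

lemma grad_back_triple:
  "triple w (\<lambda>s. taped s \<and> (\<forall>l<N. rarr s 6 l = 0)) (Seq seed (Repeat 9 grad_back_body))
     (5 + length P * 8) (\<lambda>s. taped s \<and> adj_inv m s)"
proof -
  define I where "I k s \<longleftrightarrow> taped s \<and> reg s 2 = N - 1 - k \<and> adj_inv (N - 1 - k) s" for k s
  have "triple w (\<lambda>s. taped s \<and> (\<forall>l<N. rarr s 6 l = 0)) seed (static_cost w seed)
      (\<lambda>s. I 0 s \<and> reg s 9 = length P)"
    by (rule triple_loop_free) (auto simp: I_def seed_effect simp del: One_nat_def, simp add: seed_def)
  moreover have "triple w (\<lambda>s. I 0 s \<and> reg s 9 = length P) (Repeat 9 grad_back_body)
     (1 + length P * (1 + static_cost w grad_back_body)) (I (length P))"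
  proof (rule triple_Repeat)
    fix k s assume k: "k < length P" and "I k s"
    then have s: "taped s" "reg s 2 = N - 1 - k" "adj_inv (N - 1 - k) s" by (auto simp: I_def)
    have l: "m < N - 1 - k" "N - 1 - k < N" using k by (auto simp: num_nodes_def)
    show "I (Suc k) (run grad_back_body s)"
      using grad_back_effect(1,2)[OF s(1,2) l] grad_back_adj_inv[OF s(1,2) l s(3)] by (simp add: I_def)
  qed (auto simp: grad_back_body_def)
  ultimately show ?thesis
    by (rule triple_conseq_cost[OF triple_Seq]) (auto simp: I_def seed_def grad_back_body_def num_nodes_def)
qed

text \<open>Among the initial nodes only the input \<open>x\<^sub>j\<close>, which is node \<open>j + 1\<close> when components are counted from 0,
  depends on component \<open>j\<close>.\<close>

lemma sum_inputs:
  assumes "j < m"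
  shows "(\<Sum>k\<le>m. a k * dnode P x k j) = a (Suc j)"
proof -
  have "dnode P x k j = (if k = Suc j then 1 else 0)" if "k \<le> m" for k
    using that dnode_0[OF x] dnode_input[OF x] by (cases k) auto
  then have "(\<Sum>k\<le>m. a k * dnode P x k j) = (\<Sum>k\<le>m. if k = Suc j then a k else 0)"
    by (intro sum.cong) auto
  then show ?thesis using assms by simp
qed

lemma grad_out_triple:
  "triple w (\<lambda>s. taped s \<and> adj_inv m s) (Seq (Do (NConst 2 0)) (Repeat 0 grad_out_body))
     (2 + m * 4) (\<lambda>s. output_vec s = vec m (dnode P x (N - 1)))"
proof -
  define I where "I k s \<longleftrightarrow> taped s \<and> reg s 2 = k \<and> (\<forall>j<m. rarr s 6 (Suc j) = dnode P x (N - 1) j) \<and>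
    (\<forall>j<k. varr s 1 0 $ j = dnode P x (N - 1) j)" for k s
  have "triple w (\<lambda>s. taped s \<and> adj_inv m s) (Do (NConst 2 0)) (static_cost w (Do (NConst 2 0))) (I 0)"
    by (rule triple_loop_free) (auto simp: I_def taped_set_reg adj_inv_def sum_inputs)
  moreover have "triple w (I 0) (Repeat 0 grad_out_body) (1 + m * (1 + static_cost w grad_out_body)) (I m)"
  proof (rule triple_Repeat)
    fix k s assume k: "k < m" and "I k s"
    then have s: "taped s" "reg s 2 = k" "\<And>j. j < m \<Longrightarrow> rarr s 6 (Suc j) = dnode P x (N - 1) j"
       "\<And>j. j < k \<Longrightarrow> varr s 1 0 $ j = dnode P x (N - 1) j" by (auto simp: I_def)
    have "taped (run grad_out_body s)"
      by (rule tapedI[OF s(1)])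
        (simp_all add: grad_out_body_def taped_base[OF s(1)] rd_def wr_def update_vec_carrier)
    then show "I (Suc k) (run grad_out_body s)"
      using s k by (auto simp: I_def grad_out_body_def taped_base[OF s(1)] rd_def wr_def less_Suc_eq update_vec_def)
  qed (auto simp: I_def grad_out_body_def taped_base)
  ultimately show ?thesis
    by (rule triple_conseq_cost[OF triple_Seq])
      (auto simp: I_def grad_out_body_def output_vec_def taped_base intro!: eq_vecI)
qed

lemma gradient_triple:
  "triple w (input_state m P x) gradient_prog (100 * N) (\<lambda>s. output_vec s = vec m (dnode P x (N - 1)))"
  unfolding gradient_prog_def
  by (rule triple_conseq_cost[OF triple_Seq[OF linearize_triple triple_Seq[OF zero_adj_triple
        triple_Seq[OF grad_back_triple grad_out_triple]]]])
     (simp_all add: lin_body_def num_nodes_def)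

section \<open>The passes for the Hessian\<close>

lemma zero_vec_triple:
  "triple w taped (Seq (Do (NConst 2 0)) (Repeat 1 zero_vec_body)) (2 + N * (3 + 2 * w))
     (\<lambda>s. taped s \<and> (\<forall>l<N. varr s 2 l = 0\<^sub>v m \<and> varr s 3 l = 0\<^sub>v m \<and> rarr s 6 l = 0))"
proof -
  define I where "I k s \<longleftrightarrow> taped s \<and> reg s 2 = k \<and>
    (\<forall>l<k. varr s 2 l = 0\<^sub>v m \<and> varr s 3 l = 0\<^sub>v m \<and> rarr s 6 l = 0)" for k s
  have "triple w taped (Do (NConst 2 0)) (static_cost w (Do (NConst 2 0))) (I 0)"
    by (rule triple_loop_free) (auto simp: I_def taped_set_reg)
  moreover have "triple w (I 0) (Repeat 1 zero_vec_body) (1 + N * (1 + static_cost w zero_vec_body)) (I N)"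
  proof (rule triple_Repeat)
    fix k s assume "k < N" "I k s"
    then have s: "taped s" "reg s 2 = k"
      "\<And>l. l < k \<Longrightarrow> varr s 2 l = 0\<^sub>v m \<and> varr s 3 l = 0\<^sub>v m \<and> rarr s 6 l = 0" by (auto simp: I_def)
    have z: "varr s a i - varr s a i = 0\<^sub>v m" for a i
      by (rule minus_cancel_vec) (rule taped_base[OF s(1)])
    have "taped (run zero_vec_body s)"
      by (rule tapedI[OF s(1)]) (simp_all add: zero_vec_body_def taped_base[OF s(1)] rd_def wr_def z)
    then show "I (Suc k) (run zero_vec_body s)"
      using s(2,3) by (auto simp: I_def zero_vec_body_def taped_base[OF s(1)] rd_def wr_def less_Suc_eq z)
  qed (auto simp: I_def zero_vec_body_def taped_base)
  ultimately show ?thesis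
    by (rule triple_conseq_cost[OF triple_Seq]) (auto simp: I_def zero_vec_body_def algebra_simps)
qed

text \<open>The adjoints and their gradients are 0.\<close>

definition adj_zero :: "state \<Rightarrow> bool" where
  "adj_zero s \<longleftrightarrow> taped s \<and> (\<forall>l<N. varr s 3 l = 0\<^sub>v m \<and> rarr s 6 l = 0)"

lemma unit_triple:
  "triple w (\<lambda>s. taped s \<and> (\<forall>l<N. varr s 2 l = 0\<^sub>v m \<and> varr s 3 l = 0\<^sub>v m \<and> rarr s 6 l = 0))
     (Seq (block [NConst 2 0, ROfNat (7, 3) 4]) (Repeat 0 unit_body)) (3 + m * 4)
     (\<lambda>s. adj_zero s \<and> reg s 2 = m \<and> tangents_upto (Suc m) s)"
proof -
  define I where "I k s \<longleftrightarrow> adj_zero s \<and> reg s 2 = k \<and> rarr s 7 0 = 1 \<and>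
    (\<forall>l\<le>m. \<forall>i<m. varr s 2 l $ i = (if l = Suc i \<and> i < k then 1 else 0))" for k s
  have "triple w (\<lambda>s. taped s \<and> (\<forall>l<N. varr s 2 l = 0\<^sub>v m \<and> varr s 3 l = 0\<^sub>v m \<and> rarr s 6 l = 0))
     (block [NConst 2 0, ROfNat (7, 3) 4]) (static_cost w (block [NConst 2 0, ROfNat (7, 3) 4])) (I 0)"
  proof (rule triple_loop_free)
    fix s assume s: "taped s \<and> (\<forall>l<N. varr s 2 l = 0\<^sub>v m \<and> varr s 3 l = 0\<^sub>v m \<and> rarr s 6 l = 0)"
    let ?s = "run (block [NConst 2 0, ROfNat (7, 3) 4]) s"
    have "taped ?s"
      by (rule tapedI[of s]) (use s in \<open>simp_all add: taped_base rd_def wr_def\<close>)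
    then show "I 0 ?s"
      using s by (simp add: I_def adj_zero_def taped_base rd_def wr_def num_nodes_def)
  qed simp
  moreover have "triple w (I 0) (Repeat 0 unit_body) (1 + m * (1 + static_cost w unit_body)) (I m)"
  proof (rule triple_Repeat)
    fix k s assume k: "k < m" and I: "I k s"
    then have s: "taped s" "reg s 2 = k" "rarr s 7 0 = 1"
      "\<And>l i. l \<le> m \<Longrightarrow> i < m \<Longrightarrow> varr s 2 l $ i = (if l = Suc i \<and> i < k then 1 else 0)"
      "\<And>l. l < N \<Longrightarrow> varr s 3 l = 0\<^sub>v m \<and> rarr s 6 l = 0"
      by (auto simp: I_def adj_zero_def)
    have t: "taped (run unit_body s)"
      by (rule tapedI[OF s(1)]) (simp_all add: unit_body_def taped_base[OF s(1)] rd_def wr_def update_vec_carrier)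
    have "varr (run unit_body s) 2 l $ i = (if l = Suc i \<and> i < Suc k then 1 else 0)" if "l \<le> m" "i < m" for l i
      using s(4)[OF that] k that
      by (auto simp: unit_body_def taped_base[OF s(1)] rd_def wr_def update_vec_def s(2,3))
    then show "I (Suc k) (run unit_body s)"
      using s(2,3,5) t by (simp add: I_def adj_zero_def unit_body_def taped_base[OF s(1)] rd_def wr_def)
  qed (auto simp: I_def adj_zero_def unit_body_def taped_base)
  ultimately have *: "triple w (\<lambda>s. taped s \<and> (\<forall>l<N. varr s 2 l = 0\<^sub>v m \<and> varr s 3 l = 0\<^sub>v m \<and> rarr s 6 l = 0))
     (Seq (block [NConst 2 0, ROfNat (7, 3) 4]) (Repeat 0 unit_body))
     (static_cost w (block [NConst 2 0, ROfNat (7, 3) 4]) + (1 + m * (1 + static_cost w unit_body))) (I m)"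
    by (rule triple_Seq)
  have "tangents_upto (Suc m) s" if "I m s" for s
    unfolding tangents_upto_def
  proof (intro allI impI)
    fix l i assume "l < Suc m" "i < m"
    then show "varr s 2 l $ i = dnode P x l i"
      using that dnode_0[OF x] dnode_input[OF x] by (cases l) (auto simp: I_def)
  qed
  then show ?thesis
    by (intro triple_conseq_cost[OF *]) (auto simp: I_def unit_body_def)
qed

lemma tangent_triple:
  "triple w (\<lambda>s. adj_zero s \<and> reg s 2 = m \<and> tangents_upto (Suc m) s)
     (Seq lin_start (Repeat 9 tangent_body)) (3 + length P * (4 + 3 * w))
     (\<lambda>s. adj_zero s \<and> tangents_upto N s)"
proof -
  define I where "I k s \<longleftrightarrow> adj_zero s \<and> reg s 2 = Suc (m + k) \<and> tangents_upto (Suc (m + k)) s" for k s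
  have "triple w (\<lambda>s. adj_zero s \<and> reg s 2 = m \<and> tangents_upto (Suc m) s) lin_start (static_cost w lin_start)
     (\<lambda>s. I 0 s \<and> reg s 9 = length P)"
  proof (rule triple_loop_free)
    fix s assume s: "adj_zero s \<and> reg s 2 = m \<and> tangents_upto (Suc m) s"
    then have t: "taped s" by (simp add: adj_zero_def)
    have "taped (run lin_start s)"
      by (rule tapedI[OF t]) (simp_all add: lin_start_def taped_base[OF t])
    then show "I 0 (run lin_start s) \<and> reg (run lin_start s) 9 = length P"
      using s by (simp add: I_def adj_zero_def tangents_upto_def lin_start_def taped_base[OF t] num_nodes_def)
  qed (simp add: lin_start_def)
  moreover have "triple w (\<lambda>s. I 0 s \<and> reg s 9 = length P) (Repeat 9 tangent_body)
     (1 + length P * (1 + static_cost w tangent_body)) (I (length P))"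
  proof (rule triple_Repeat)
    fix k s assume k: "k < length P" and I: "I k s"
    define l where "l = Suc (m + k)"
    have l: "m < l" "l < N" using k by (auto simp: l_def num_nodes_def)
    have s: "taped s" "reg s 2 = l" "\<And>l' i. l' < l \<Longrightarrow> i < m \<Longrightarrow> varr s 2 l' $ i = dnode P x l' i"
      "\<And>l. l < N \<Longrightarrow> varr s 3 l = 0\<^sub>v m \<and> rarr s 6 l = 0"
      using I by (auto simp: I_def adj_zero_def tangents_upto_def l_def)
    note less = ops_less[OF l] 
    have neq: "fst_op l \<noteq> l" "snd_op l \<noteq> l" using less by auto
    note simps = tangent_body_def taped_base[OF s(1)] taped_entry[OF s(1) l] rd_def wr_def s(2) neq
    have t: "taped (run tangent_body s)"
      by (rule tapedI[OF s(1)]) (simp_all add: simps add_carrier_vec)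
    have tan: "varr (run tangent_body s) 2 l' $ i = dnode P x l' i" if "l' < Suc l" "i < m" for l' i
      using that less s(3) by (cases "l' = l") (simp_all add: simps dnode_tape[OF l])
    show "I (Suc k) (run tangent_body s)"
      using t tan s(4) unfolding I_def adj_zero_def tangents_upto_def l_def[symmetric] add_Suc_right
      by (simp add: simps)
  qed (auto simp: tangent_body_def)
  ultimately show ?thesis
    by (rule triple_conseq_cost[OF triple_Seq])
      (auto simp: I_def lin_start_def tangent_body_def num_nodes_def algebra_simps)
qed

lemma hess_back_vec_effect:
  assumes s: "taped s" and l: "reg s 2 = l" "m < l" "l < N"
  shows "taped (run hess_back_vec s)" "reg (run hess_back_vec s) 2 = l"
    "rarr (run hess_back_vec s) 6 = rarr s 6"
    "varr (run hess_back_vec s) 2 = varr s 2"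
    "i < m \<Longrightarrow> (\<lambda>k. varr (run hess_back_vec s) 3 k $ i) =
       bump (bump (\<lambda>k. varr s 3 k $ i)
         (fst_op l) (c1 l * varr s 3 l $ i + c11 l * rarr s 6 l * varr s 2 (fst_op l) $ i
                      + c12 l * rarr s 6 l * varr s 2 (snd_op l) $ i))
         (snd_op l) (c2 l * varr s 3 l $ i + c12 l * rarr s 6 l * varr s 2 (fst_op l) $ i)"
proof -
  have less: "fst_op l \<noteq> l" "snd_op l \<noteq> l" "l \<noteq> fst_op l" "l \<noteq> snd_op l"
    using ops_less[OF l(2,3)] by auto
  note simps = hess_back_vec_def rd_def wr_def taped_base[OF s] taped_entry[OF s l(2,3)] l(1) less
  show "taped (run hess_back_vec s)" by (rule tapedI[OF s]) (simp_all add: simps add_carrier_vec)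
  show "reg (run hess_back_vec s) 2 = l" by (simp add: simps)
  show "rarr (run hess_back_vec s) 6 = rarr s 6" by (simp add: simps)
  show "varr (run hess_back_vec s) 2 = varr s 2" by (simp add: simps)
  show "(\<lambda>k. varr (run hess_back_vec s) 3 k $ i) =
       bump (bump (\<lambda>k. varr s 3 k $ i)
         (fst_op l) (c1 l * varr s 3 l $ i + c11 l * rarr s 6 l * varr s 2 (fst_op l) $ i
                      + c12 l * rarr s 6 l * varr s 2 (snd_op l) $ i))
         (snd_op l) (c2 l * varr s 3 l $ i + c12 l * rarr s 6 l * varr s 2 (fst_op l) $ i)"
    if "i < m"
    using that by (intro ext) (simp add: simps bump_def)
qed

lemma hess_back_adj_vec_inv:
  assumes s: "taped s" and l: "reg s 2 = l" "m < l" "l < N"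
    and adj: "adj_vec_inv l s" and tan: "tangents_upto N s"
  shows "adj_vec_inv (l - 1) (run hess_back_body s)"
  unfolding adj_vec_inv_def
proof (intro allI impI)
  fix i j assume ij: "i < m" "j < m"
  obtain n where n: "l = Suc n" using l(2) by (cases l) auto
  then have ln: "l - 1 = n" by simp
  have less: "fst_op l \<in> {..n}" "snd_op l \<in> {..n}" using ops_less[OF l(2,3)] n by auto
  let ?g = "\<lambda>k. dnode P x k j" and ?h = "\<lambda>k. ddnode P x k i j"
  let ?s = "run hess_back_vec s" and ?t = "run hess_back_body s"
  have tan': "varr s 2 k $ i = dnode P x k i" if "k < N" for k
    using tan that ij by (simp add: tangents_upto_def)
  have t: "rarr ?t 6 = bump (bump (rarr s 6) (fst_op l) (c1 l * rarr s 6 l)) (snd_op l) (c2 l * rarr s 6 l)"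
    "varr ?t = varr ?s"
    using grad_back_effect(3,4)[OF hess_back_vec_effect(1,2)[OF s l] l(2,3)]
    by (simp_all add: hess_back_body_def hess_back_vec_effect[OF s l])
  have A: "(\<Sum>k\<le>n. varr ?t 3 k $ i * ?g k) = (\<Sum>k\<le>n. varr s 3 k $ i * ?g k)
      + (c1 l * varr s 3 l $ i + c11 l * rarr s 6 l * dnode P x (fst_op l) i
         + c12 l * rarr s 6 l * dnode P x (snd_op l) i) * ?g (fst_op l)
      + (c2 l * varr s 3 l $ i + c12 l * rarr s 6 l * dnode P x (fst_op l) i) * ?g (snd_op l)"
    using ops_less[OF l(2,3)] l(3)
    by (simp only: t(2) hess_back_vec_effect(5)[OF s l ij(1), THEN fun_cong]
        sum_bump[OF _ less(1)] sum_bump[OF _ less(2)] finite_atMost tan' order.strict_trans[of _ l N])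
  have B: "(\<Sum>k\<le>n. rarr ?t 6 k * ?h k) = (\<Sum>k\<le>n. rarr s 6 k * ?h k)
      + c1 l * rarr s 6 l * ?h (fst_op l) + c2 l * rarr s 6 l * ?h (snd_op l)"
    by (simp only: t(1) sum_bump[OF _ less(1)] sum_bump[OF _ less(2)] finite_atMost)
  have "(\<Sum>k\<le>n. varr ?t 3 k $ i * ?g k) + (\<Sum>k\<le>n. rarr ?t 6 k * ?h k)
     = (\<Sum>k\<le>n. varr s 3 k $ i * ?g k) + varr s 3 l $ i * ?g l
       + ((\<Sum>k\<le>n. rarr s 6 k * ?h k) + rarr s 6 l * ?h l)"
    unfolding A B dnode_tape[OF l(2,3), of j] ddnode_tape[OF l(2,3)] by (simp add: algebra_simps)
  also have "\<dots> = (\<Sum>k\<le>l. varr s 3 k $ i * ?g k) + (\<Sum>k\<le>l. rarr s 6 k * ?h k)"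
    by (simp add: n)
  finally show "(\<Sum>k\<le>l - 1. varr ?t 3 k $ i * ?g k) + (\<Sum>k\<le>l - 1. rarr ?t 6 k * ?h k)
     = ddnode P x (N - 1) i j"
    unfolding ln using adj ij by (simp add: adj_vec_inv_def)
qed

lemma hess_back_triple:
  "triple w (\<lambda>s. adj_zero s \<and> tangents_upto N s) (Seq seed (Repeat 9 hess_back_body))
     (5 + length P * (12 + 10 * w)) (\<lambda>s. taped s \<and> adj_vec_inv m s)"
proof -
  define I where "I k s \<longleftrightarrow> taped s \<and> reg s 2 = N - 1 - k \<and> tangents_upto N s \<and> adj_vec_inv (N - 1 - k) s" for k s
  have "triple w (\<lambda>s. adj_zero s \<and> tangents_upto N s) seed (static_cost w seed)
      (\<lambda>s. I 0 s \<and> reg s 9 = length P)"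
  proof (rule triple_loop_free)
    fix s assume s: "adj_zero s \<and> tangents_upto N s"
    then have s': "taped s" "\<And>l. l < N \<Longrightarrow> rarr s 6 l = 0" "\<And>l. l < N \<Longrightarrow> varr s 3 l = 0\<^sub>v m"
      by (auto simp: adj_zero_def)
    note eff = seed_effect[OF s'(1,2)]
    have "(\<Sum>k\<le>N - 1. varr s 3 k $ i * g k) = 0" if "i < m" for i g
      by (intro sum.neutral) (use s'(3) that in \<open>auto simp: num_nodes_def\<close>)
    then have "adj_vec_inv (N - 1) (run seed s)"
      unfolding adj_vec_inv_def by (simp add: eff(4,6) del: One_nat_def)
    then show "I 0 (run seed s) \<and> reg (run seed s) 9 = length P"
      using s eff(1-4) by (simp add: I_def tangents_upto_def)
  qed (simp add: seed_def)
  moreover have "triple w (\<lambda>s. I 0 s \<and> reg s 9 = length P) (Repeat 9 hess_back_body)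
     (1 + length P * (1 + static_cost w hess_back_body)) (I (length P))"
  proof (rule triple_Repeat)
    fix k s assume k: "k < length P" and "I k s"
    then have s: "taped s" "reg s 2 = N - 1 - k" "tangents_upto N s" "adj_vec_inv (N - 1 - k) s"
      by (auto simp: I_def)
    have l: "m < N - 1 - k" "N - 1 - k < N" using k by (auto simp: num_nodes_def)
    note vec = hess_back_vec_effect[OF s(1,2) l]
    note eff = grad_back_effect[OF vec(1,2) l]
    show "I (Suc k) (run hess_back_body s)"
      using eff(1-3) vec(4) hess_back_adj_vec_inv[OF s(1,2) l s(4,3)] s(3)
      by (simp add: I_def tangents_upto_def) (simp add: hess_back_body_def)
  qed (auto simp: hess_back_body_def hess_back_vec_def grad_back_body_def)
  ultimately show ?thesis
    by (rule triple_conseq_cost[OF triple_Seq])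
      (auto simp: I_def seed_def hess_back_body_def hess_back_vec_def grad_back_body_def num_nodes_def algebra_simps)
qed

lemma hess_out_triple:
  "triple w (\<lambda>s. taped s \<and> adj_vec_inv m s)
     (Seq (block [NConst 2 0, ROfNat (7, 3) 4]) (Repeat 0 hess_out_body)) (3 + m * (3 + w))
     (\<lambda>s. output_mat m s = mat m m (\<lambda>(i, j). ddnode P x (N - 1) i j))"
proof -
  define I where "I k s \<longleftrightarrow> taped s \<and> reg s 2 = k \<and> rarr s 7 0 = 1 \<and>
    (\<forall>j<m. \<forall>i<m. varr s 3 (Suc j) $ i = ddnode P x (N - 1) i j) \<and>
    (\<forall>j<k. \<forall>i<m. varr s 1 j $ i = ddnode P x (N - 1) i j)" for k s
  have "triple w (\<lambda>s. taped s \<and> adj_vec_inv m s) (block [NConst 2 0, ROfNat (7, 3) 4])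
     (static_cost w (block [NConst 2 0, ROfNat (7, 3) 4])) (I 0)"
  proof (rule triple_loop_free)
    fix s assume s: "taped s \<and> adj_vec_inv m s"
    let ?s = "run (block [NConst 2 0, ROfNat (7, 3) 4]) s"
    have "taped ?s"
      by (rule tapedI[of s]) (use s in \<open>simp_all add: taped_base rd_def wr_def\<close>)
    moreover have "varr s 3 (Suc j) $ i = ddnode P x (N - 1) i j" if "i < m" "j < m" for i j
      using s that sum_inputs[OF that(2), of "\<lambda>k. varr s 3 k $ i"] ddnode_initial[OF x]
      by (simp add: adj_vec_inv_def)
    ultimately show "I 0 ?s"
      using s by (simp add: I_def taped_base rd_def wr_def)
  qed simp
  moreover have "triple w (I 0) (Repeat 0 hess_out_body) (1 + m * (1 + static_cost w hess_out_body)) (I m)"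
  proof (rule triple_Repeat)
    fix k s assume k: "k < m" and "I k s"
    then have s: "taped s" "reg s 2 = k" "rarr s 7 0 = 1"
      "\<And>i j. i < m \<Longrightarrow> j < m \<Longrightarrow> varr s 3 (Suc j) $ i = ddnode P x (N - 1) i j"
      "\<And>i j. i < m \<Longrightarrow> j < k \<Longrightarrow> varr s 1 j $ i = ddnode P x (N - 1) i j" by (auto simp: I_def)
    note simps = hess_out_body_def taped_base[OF s(1)] rd_def wr_def s(2,3)
    have "taped (run hess_out_body s)"
      by (rule tapedI[OF s(1)]) (simp_all add: simps)
    then show "I (Suc k) (run hess_out_body s)"
      using s(4,5) k by (simp add: I_def simps less_Suc_eq)
  qed (auto simp: I_def hess_out_body_def taped_base)
  ultimately have *: "triple w (\<lambda>s. taped s \<and> adj_vec_inv m s)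
     (Seq (block [NConst 2 0, ROfNat (7, 3) 4]) (Repeat 0 hess_out_body))
     (static_cost w (block [NConst 2 0, ROfNat (7, 3) 4]) + (1 + m * (1 + static_cost w hess_out_body))) (I m)"
    by (rule triple_Seq)
  have "output_mat m s = mat m m (\<lambda>(i, j). ddnode P x (N - 1) i j)" if "I m s" for s
  proof (rule eq_matI)
    fix i j assume "i < dim_row (mat m m (\<lambda>(i, j). ddnode P x (N - 1) i j))"
      "j < dim_col (mat m m (\<lambda>(i, j). ddnode P x (N - 1) i j))"
    then have ij: "i < m" "j < m" by auto
    \<comment> \<open>The invariant describes columns, the output consists of rows.\<close>
    have "output_mat m s $$ (i, j) = ddnode P x (N - 1) j i"
      using that ij by (simp add: output_mat_def mat_of_rows_def I_def)
    also have "\<dots> = ddnode P x (N - 1) i j"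
      by (rule ddnode_commute[OF wf x]) (simp add: num_nodes_def)
    finally show "output_mat m s $$ (i, j) = mat m m (\<lambda>(i, j). ddnode P x (N - 1) i j) $$ (i, j)"
      using ij by simp
  qed (simp_all add: output_mat_def)
  then show ?thesis
    by (intro triple_conseq_cost[OF *]) (auto simp: hess_out_body_def algebra_simps)
qed

lemma hessian_triple:
  assumes "w \<ge> 1"
  shows "triple w (input_state m P x) hessian_prog (100 * (w * N))
    (\<lambda>s. output_mat m s = mat m m (\<lambda>(i, j). ddnode P x (N - 1) i j))"
  unfolding hessian_prog_def
proof (rule triple_conseq_cost[OF triple_Seq[OF linearize_triple triple_Seq[OF zero_vec_triple
        triple_Seq[OF unit_triple triple_Seq[OF tangent_triple triple_Seq[OF hess_back_triple hess_out_triple]]]]]])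
  \<comment> \<open>The substitution turns the claim into a comparison of coefficients.\<close>
  obtain v where "w = Suc v" using assms by (cases w) auto
  then show "5 + m * 4 + (3 + length P * (1 + static_cost w lin_body)) + (2 + N * (3 + 2 * w) +
     (3 + m * 4 + (3 + length P * (4 + 3 * w) + (5 + length P * (12 + 10 * w) + (3 + m * (3 + w))))))
     \<le> 100 * (w * N)"
    by (simp add: lin_body_def num_nodes_def algebra_simps)
qed

end

section \<open>Cost of gradient and Hessian\<close>

theorem theorem3p1:
  shows "(\<exists>G C. \<forall>m p P x s.
            polynomial_in m p \<and> represents m P p \<and> x \<in> carrier_vec m \<and> input_state m P x s \<longrightarrow>
              output_vec (run G s) = gradient m p x \<and>
              scalar_ops m G s \<le> C * num_nodes m P) \<and>
         (\<exists>H C. \<forall>m p P x s.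
            polynomial_in m p \<and> represents m P p \<and> x \<in> carrier_vec m \<and> input_state m P x s \<longrightarrow>
              output_mat m (run H s) = hessian m p x \<and>
              vector_ops H s \<le> C * num_nodes m P \<and>
              (m \<ge> 1 \<longrightarrow> scalar_ops m H s \<le> C * m * num_nodes m P))"
proof (intro conjI exI allI impI; (elim conjE)?)
  fix m p P x s
  assume rep: "represents m P p" and x: "x \<in> carrier_vec m" and s: "input_state m P x s"
  interpret slp_point m P x
    using rep x by unfold_locales (auto simp: represents_def)
  show "output_vec (run gradient_prog s) = gradient m p x"
    using gradient_triple[of m] s by (simp add: triple_def gradient_eq_dnode[OF rep x])
  show "scalar_ops m gradient_prog s \<le> 100 * num_nodes m P"
    using gradient_triple[of m] s by (simp add: triple_def scalar_ops_def)
next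
  fix m p P x s
  assume rep: "represents m P p" and x: "x \<in> carrier_vec m" and s: "input_state m P x s"
  interpret slp_point m P x
    using rep x by unfold_locales (auto simp: represents_def)
  show "output_mat m (run hessian_prog s) = hessian m p x"
    using hessian_triple[of 1] s by (simp add: triple_def hessian_eq_ddnode[OF rep x])
  show "vector_ops hessian_prog s \<le> 100 * num_nodes m P"
    using hessian_triple[of 1] s by (simp add: triple_def vector_ops_def)
  show "scalar_ops m hessian_prog s \<le> 100 * m * num_nodes m P" if "m \<ge> 1"
    using hessian_triple[OF that] s by (simp add: triple_def scalar_ops_def mult.assoc)
qed

end
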